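(* Let $\mathfrak{H}$ be a separable Hilbert space and let $T(\lambda)=T_0+\lambda T_1$, $\lambda\in\mathbb{T}$, be a contractive linear pencil of operators on $\mathfrak{H}$. Let $\mathfrak{Y}$ be a separable Hilbert space and $F(z)=F_0+zF_1$ a linear outer function, with $F_0,F_1$ bounded linear operators from $\mathfrak{H}$ to $\mathfrak{Y}$, such that $F(\lambda)^*F(\lambda)=I_{\mathfrak{H}}-T(\lambda)^*T(\lambda)$ for all $\lambda\in\mathbb{T}$. Set $\mathfrak{K}_+:=\left(\bigoplus_{-\infty}^{-1}\mathfrak{Y}\right)\oplus\mathfrak{H}$ and define the isometric linear pencil $V(\lambda)=V_0+\lambda V_1$ on $\mathfrak{K}_+$ by $$V(\lambda)(\ldots,y_{-2},y_{-1},h):=(\ldots,y_{-2},y_{-1},F(\lambda)h,T(\lambda)h)\qquad(\lambda\in\mathbb{T}),$$ where on the right-hand side $T(\lambda)h$ is the $\mathfrak{H}$-component, $F(\lambda)h$ is the component in the $(-1)$-st copy of $\mathfrak{Y}$, and $y_{-k}$ is the component in the $(-k-1)$-st copy of $\mathfrak{Y}$ for $k\ge1$. Set $$\mathfrak{V}:=\bigvee_{\lambda\in\mathbb{T}}V(\lambda)\mathfrak{K}_+=\overline{V_0\mathfrak{K}_+}\oplus\overline{V_1\mathfrak{K}_+},\qquad \mathfrak{L}:=\mathfrak{K}_+\ominus\mathfrak{V},\qquad \mathfrak{K}_\lambda:=\mathfrak{V}\ominus V(\lambda)\mathfrak{K}_+\quad(\lambda\in\mathbb{T}),$$ $$P(\lambda):=P_{\overline{V_0\mathfrak{K}_+}}+\lambda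 P_{\overline{V_1\mathfrak{K}_+}}\ \text{ on } \mathfrak{V}\qquad(\lambda\in\mathbb{T}),$$ $\mathfrak{U}:=\mathfrak{K}_1\oplus\mathfrak{L}$ (where $\mathfrak{K}_1$ is $\mathfrak{K}_\lambda$ for $\lambda=1$), and define $Q(\lambda):\mathfrak{U}\to\mathfrak{K}_+$ by $Q(\lambda)(k\oplus l):=P(\lambda)k+l$ for $k\in\mathfrak{K}_1$, $l\in\mathfrak{L}$. Let $$\mathfrak{K}:=\mathfrak{K}_+\oplus\left(\bigoplus_{n=1}^{\infty}\mathfrak{U}\right)=\left(\bigoplus_{-\infty}^{-1}\mathfrak{Y}\right)\oplus\mathfrak{H}\oplus\left(\bigoplus_{1}^{\infty}\mathfrak{U}\right),$$ and for $\lambda\in\mathbb{T}$ define $U(\lambda):\mathfrak{K}\to\mathfrak{K}$ by $$U(\lambda)(\ldots,y_{-2},y_{-1},h,u_1,u_2,\ldots):=(\ldots,y_{-2},y_{-1},\ F(\lambda)h+P_{\mathfrak{Y}}Q(\lambda)u_1,\ T(\lambda)h+P_{\mathfrak{H}}Q(\lambda)u_1,\ u_2,u_3,\ldots),$$ where on the right-hand side $T(\lambda)h+P_{\mathfrak{H}}Q(\lambda)u_1$ is the $\mathfrak{H}$-component, $F(\lambda)h+P_{\mathfrak{Y}}Q(\lambda)u_1$ is the component in the $(-1)$-st copy of $\mathfrak{Y}$, $y_{-k}$ is the component in the $(-k-1)$-st copy of $\mathfrak{Y}$ and $u_{k+1}$ is the component in the $k$-th copy of $\mathfrak{U}$ for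 $k\ge1$. Then $U(\lambda)$, $\lambda\in\mathbb{T}$, is a minimal unitary dilation of $T(\lambda)$. Moreover, $U(\lambda)$ is a minimal uniform unitary dilation of $T(\lambda)$.
   Context: Hilbert spaces are complex; subspaces are closed; $\mathbb{T}=\{\lambda\in\mathbb{C}:|\lambda|=1\}$; $\mathbb{D}$ is the open unit disk; $\mathbb{Z}_+=\{0,1,2,\dots\}$; $P_{\mathfrak{M}}$ is the orthogonal projector onto a subspace $\mathfrak{M}$, and $P_{\mathfrak{Y}}$ denotes the projector of $\mathfrak{K}_+$ onto the $(-1)$-st copy of $\mathfrak{Y}$ (the one adjacent to $\mathfrak{H}$); $A|\mathfrak{M}$ is the restriction of $A$ to $\mathfrak{M}$; $\bigvee$ denotes the closure of the linear span of the indicated subsets; $\ominus$ denotes orthogonal complement. $\mathfrak{H}$ is identified with its copy in $\mathfrak{K}_+\subset\mathfrak{K}$. The subspaces $\overline{V_0\mathfrak{K}_+}$ and $\overline{V_1\mathfrak{K}_+}$ are orthogonal because $V(\lambda)$ is isometric for all $\lambda\in\mathbb{T}$. A linear pencil on $\mathfrak{H}$ is a family $T(\lambda)=T_0+\lambda T_1$, $\lambda\in\mathbb{T}$, with $T_0,T_1$ bounded linear operators on $\mathfrak{H}$. It is called contractive (resp. isometric, unitary) if $T(\lambda)$ is a contraction (resp. an isometry, a unitary operator) for every $\lambda\in\mathbb{T}$. For a separable Hilbert space $\mathfrak{X}$, $H^2_{\mathfrak{X}}(\mathbb{D})$ is the Hardy space of holomorphic $\mathfrak{X}$-valued functions $x$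 on $\mathbb{D}$ with $\|x\|^2=(2\pi)^{-1}\sup_{0<r<1}\int_0^{2\pi}\|x(re^{is})\|^2\,ds<\infty$. A contractive holomorphic function $\theta$ on $\mathbb{D}$, whose values are bounded operators from $\mathfrak{X}$ to $\mathfrak{X}_*$ (separable Hilbert spaces), is outer if $\theta H^2_{\mathfrak{X}}(\mathbb{D})$ is dense in $H^2_{\mathfrak{X}_*}(\mathbb{D})$. By the operator Fejér–Riesz theorem, a space $\mathfrak{Y}$ and a linear outer function $F$ with the required factorization property exist for every contractive linear pencil $T(\lambda)$, and $F$ is unique up to a unitary operator factor from the left. A linear pencil $\widetilde{T}(\lambda)$ on a Hilbert space $\widetilde{\mathfrak{H}}$ is a dilation of a linear pencil $T(\lambda)$ on $\mathfrak{H}$ if $\widetilde{\mathfrak{H}}\supset\mathfrak{H}$ and $T(\lambda)^n=P_{\mathfrak{H}}\widetilde{T}(\lambda)^n|\mathfrak{H}$ for all $\lambda\in\mathbb{T}$ and $n\in\mathbb{Z}_+$. The dilation is uniform if $T(\lambda_1)\cdots T(\lambda_n)=P_{\mathfrak{H}}\widetilde{T}(\lambda_1)\cdots\widetilde{T}(\lambda_n)|\mathfrak{H}$ for all $n\in\mathbb{N}$ and all $\lambda_1,\dots,\lambda_n\in\mathbb{T}$. A unitary dilation of a contractive linear pencil is a dilation that is a unitary linear pencil. A unitary dilation (resp. uniform unitary dilation) $\widetilde{T}(\lambda)$ of $T(\lambda)$ on $\widetilde{\mathfrak{H}}$ is minimal if it is minimal in the natural partial order on the set of all unitary dilations (resp.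 all uniform unitary dilations) of $T(\lambda)$; that is, whenever $\mathfrak{H}'$ is a subspace with $\mathfrak{H}\subset\mathfrak{H}'\subset\widetilde{\mathfrak{H}}$ such that the compressed pencil $T'(\lambda)=P_{\mathfrak{H}'}\widetilde{T}(\lambda)|\mathfrak{H}'$ is a unitary dilation (resp. uniform unitary dilation) of $T(\lambda)$, then $\mathfrak{H}'=\widetilde{\mathfrak{H}}$. *)

theory Defs
  imports "HOL-Analysis.Analysis"
begin

section \<open>Complex Hilbert spaces\<close>

text \<open>The real inner product inherited from \<open>real_inner\<close> is the real part of the complex
  one, so norm and topology are those of \<open>HOL-Analysis\<close>.  The complex inner product is linear
  in its first argument.\<close>

class complex_inner = real_inner +
  fixes scaleC :: "complex \<Rightarrow> 'a \<Rightarrow> 'a"  (infixr "*\<^sub>C" 75)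
    and cinner :: "'a \<Rightarrow> 'a \<Rightarrow> complex"
  assumes scaleC_add_right: "a *\<^sub>C (x + y) = a *\<^sub>C x + a *\<^sub>C y"
    and scaleC_add_left: "(a + b) *\<^sub>C x = a *\<^sub>C x + b *\<^sub>C x"
    and scaleC_scaleC: "a *\<^sub>C b *\<^sub>C x = (a * b) *\<^sub>C x"
    and scaleC_of_real: "complex_of_real r *\<^sub>C x = r *\<^sub>R x"
    and cinner_add_left: "cinner (x + y) z = cinner x z + cinner y z"
    and cinner_scaleC_left: "cinner (a *\<^sub>C x) y = a * cinner x y"
    and cinner_commute: "cinner x y = cnj (cinner y x)"
    and Re_cinner: "Re (cinner x y) = inner x y"

class complex_hilbert = complex_inner + complete_space
begin
subclass banach ..
end

lemma scaleC_one: "1 *\<^sub>C x = (x :: 'a::complex_inner)"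
  using scaleC_of_real[of 1 x] by simp

global_interpretation complex_vector:
  vector_space "scaleC :: complex \<Rightarrow> 'a \<Rightarrow> 'a::complex_inner"
  defines csubspace = complex_vector.subspace
    and cspan = complex_vector.span
  by unfold_locales (simp_all add: scaleC_add_right scaleC_add_left scaleC_scaleC scaleC_one)

lemma cinner_self: "cinner x x = complex_of_real ((norm (x :: 'a::complex_inner))\<^sup>2)"
proof -
  have "Im (cinner x x) = - Im (cinner x x)"
    using arg_cong[OF cinner_commute[of x x], of Im] by simp
  then show ?thesis
    by (simp add: complex_eq_iff Re_cinner power2_norm_eq_inner)
qed

lemma cinner_scaleC_right: "cinner x (a *\<^sub>C y) = cnj a * cinner x (y :: 'a::complex_inner)"
  by (metis cinner_commute cinner_scaleC_left complex_cnj_mult)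

lemma norm_scaleC: "norm (a *\<^sub>C x) = cmod a * norm (x :: 'a::complex_inner)"
proof -
  have "complex_of_real ((norm (a *\<^sub>C x))\<^sup>2) = a * cnj a * cinner x x"
    unfolding cinner_self[symmetric] by (simp add: cinner_scaleC_left cinner_scaleC_right)
  also have "\<dots> = complex_of_real ((cmod a * norm x)\<^sup>2)"
    unfolding cinner_self complex_norm_square[symmetric] by (simp add: power_mult_distrib)
  finally have "(norm (a *\<^sub>C x))\<^sup>2 = (cmod a * norm x)\<^sup>2"
    using of_real_eq_iff by blast
  then show ?thesis
    by (simp add: power2_eq_iff_nonneg)
qed

lemma norm_cinner_le: "cmod (cinner x y) \<le> norm x * norm (y :: 'a::complex_inner)"
proof (cases "cinner x y = 0")
  case False
  define e where "e = cnj (sgn (cinner x y))"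
  have e: "cmod e = 1"
    using False by (simp add: e_def norm_sgn)
  have "cinner (e *\<^sub>C x) y = complex_of_real (cmod (cinner x y))"
    using False complex_norm_square[of "cinner x y"]
    by (simp add: cinner_scaleC_left e_def sgn_eq power2_eq_square field_simps)
  then have "cmod (cinner x y) = inner (e *\<^sub>C x) y"
    by (metis Re_cinner Re_complex_of_real)
  also have "\<dots> \<le> norm (e *\<^sub>C x) * norm y"
    by (rule norm_cauchy_schwarz)
  finally show ?thesis
    by (simp add: norm_scaleC e)
qed simp

instantiation prod :: (complex_inner, complex_inner) complex_inner
begin

definition scaleC_prod :: "complex \<Rightarrow> 'a \<times> 'b \<Rightarrow> 'a \<times> 'b"
  where "scaleC_prod c x = (c *\<^sub>C fst x, c *\<^sub>C snd x)"

definition cinner_prod :: "'a \<times> 'b \<Rightarrow> 'a \<times> 'b \<Rightarrow> complex"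
  where "cinner_prod x y = cinner (fst x) (fst y) + cinner (snd x) (snd y)"

instance
proof
  fix a b :: complex and r :: real and x y z :: "'a \<times> 'b"
  show "cinner x y = cnj (cinner y x)"
    by (simp add: cinner_prod_def cinner_commute[symmetric])
qed (simp_all add: scaleC_prod_def cinner_prod_def scaleC_add_right scaleC_add_left scaleC_scaleC
      scaleC_of_real cinner_add_left cinner_scaleC_left Re_cinner inner_prod_def algebra_simps
      prod_eq_iff)

end

instance prod :: (complex_hilbert, complex_hilbert) complex_hilbert ..


section \<open>The Hilbert sum of countably many copies of a Hilbert space\<close>

typedef (overloaded) ('a::complex_inner) ell2 =
  "{f :: nat \<Rightarrow> 'a. summable (\<lambda>n. (norm (f n))\<^sup>2)}"
  morphisms ell2_nth Abs_ell2
  by (rule exI[of _ "\<lambda>_. 0"]) simp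

setup_lifting type_definition_ell2

lemma ell2_eqI: "(\<And>n. ell2_nth x n = ell2_nth y n) \<Longrightarrow> x = y"
  by (metis ell2_nth_inject ext)

lemma summable_ell2: "summable (\<lambda>n. (norm (ell2_nth x n))\<^sup>2)"
  using ell2_nth[of x] by simp

lemma summable_norm_add_sq:
  fixes f g :: "nat \<Rightarrow> 'a::real_normed_vector"
  assumes "summable (\<lambda>n. (norm (f n))\<^sup>2)" "summable (\<lambda>n. (norm (g n))\<^sup>2)"
  shows "summable (\<lambda>n. (norm (f n + g n))\<^sup>2)"
proof (rule summable_comparison_test')
  show "summable (\<lambda>n. 2 * (norm (f n))\<^sup>2 + 2 * (norm (g n))\<^sup>2)"
    using assms by (intro summable_add summable_mult)
  fix n
  have "(norm (f n + g n))\<^sup>2 \<le> (norm (f n) + norm (g n))\<^sup>2"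
    by (intro power_mono norm_triangle_ineq) simp
  also have "\<dots> \<le> 2 * (norm (f n))\<^sup>2 + 2 * (norm (g n))\<^sup>2"
    using sum_squares_bound[of "norm (f n)" "norm (g n)"] by (simp add: power2_sum)
  finally show "norm ((norm (f n + g n))\<^sup>2) \<le> 2 * (norm (f n))\<^sup>2 + 2 * (norm (g n))\<^sup>2"
    by simp
qed

lemma summable_norm_mult:
  fixes f g :: "nat \<Rightarrow> 'a::real_normed_vector"
  assumes "summable (\<lambda>n. (norm (f n))\<^sup>2)" "summable (\<lambda>n. (norm (g n))\<^sup>2)"
  shows "summable (\<lambda>n. norm (f n) * norm (g n))"
proof (rule summable_comparison_test')
  show "summable (\<lambda>n. (norm (f n))\<^sup>2 + (norm (g n))\<^sup>2)"
    using assms by (rule summable_add)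
  fix n
  have "0 \<le> norm (f n) * norm (g n)" by simp
  then show "norm (norm (f n) * norm (g n)) \<le> (norm (f n))\<^sup>2 + (norm (g n))\<^sup>2"
    unfolding real_norm_def using sum_squares_bound[of "norm (f n)" "norm (g n)"] by linarith
qed

instantiation ell2 :: (complex_inner) complex_inner
begin

lift_definition zero_ell2 :: "'a ell2" is "\<lambda>_. 0" by simp

lift_definition uminus_ell2 :: "'a ell2 \<Rightarrow> 'a ell2" is "\<lambda>f n. - f n" by simp

lift_definition plus_ell2 :: "'a ell2 \<Rightarrow> 'a ell2 \<Rightarrow> 'a ell2" is "\<lambda>f g n. f n + g n"
  by (rule summable_norm_add_sq)

lift_definition minus_ell2 :: "'a ell2 \<Rightarrow> 'a ell2 \<Rightarrow> 'a ell2" is "\<lambda>f g n. f n - g n"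
proof -
  fix f g :: "nat \<Rightarrow> 'a"
  assume "summable (\<lambda>n. (norm (f n))\<^sup>2)" "summable (\<lambda>n. (norm (g n))\<^sup>2)"
  then show "summable (\<lambda>n. (norm (f n - g n))\<^sup>2)"
    using summable_norm_add_sq[of f "\<lambda>n. - g n"] by simp
qed

lift_definition scaleR_ell2 :: "real \<Rightarrow> 'a ell2 \<Rightarrow> 'a ell2" is "\<lambda>r f n. r *\<^sub>R f n"
  by (simp add: power_mult_distrib summable_mult)

lift_definition scaleC_ell2 :: "complex \<Rightarrow> 'a ell2 \<Rightarrow> 'a ell2" is "\<lambda>c f n. c *\<^sub>C f n"
  by (simp add: norm_scaleC power_mult_distrib summable_mult)

definition inner_ell2 :: "'a ell2 \<Rightarrow> 'a ell2 \<Rightarrow> real"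
  where "inner_ell2 x y = (\<Sum>n. inner (ell2_nth x n) (ell2_nth y n))"

definition cinner_ell2 :: "'a ell2 \<Rightarrow> 'a ell2 \<Rightarrow> complex"
  where "cinner_ell2 x y = (\<Sum>n. cinner (ell2_nth x n) (ell2_nth y n))"

definition norm_ell2 :: "'a ell2 \<Rightarrow> real"
  where "norm_ell2 x = sqrt (inner x x)"

definition sgn_ell2 :: "'a ell2 \<Rightarrow> 'a ell2"
  where "sgn_ell2 x = scaleR (inverse (norm x)) x"

definition dist_ell2 :: "'a ell2 \<Rightarrow> 'a ell2 \<Rightarrow> real"
  where "dist_ell2 x y = norm (x - y)"

definition uniformity_ell2 :: "('a ell2 \<times> 'a ell2) filter"
  where "uniformity_ell2 = (INF e\<in>{0<..}. principal {(x, y). dist x y < e})"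

definition open_ell2 :: "'a ell2 set \<Rightarrow> bool"
  where "open_ell2 S = (\<forall>x\<in>S. \<forall>\<^sub>F (x', y) in uniformity. x' = x \<longrightarrow> y \<in> S)"

lemma summable_inner_ell2: "summable (\<lambda>n. inner (ell2_nth x n) (ell2_nth y n))"
  by (rule summable_comparison_test'[OF summable_norm_mult[OF summable_ell2[of x] summable_ell2[of y]]])
    (simp add: Cauchy_Schwarz_ineq2)

lemma summable_cinner_ell2: "summable (\<lambda>n. cinner (ell2_nth x n) (ell2_nth y n))"
  by (rule summable_comparison_test'[OF summable_norm_mult[OF summable_ell2[of x] summable_ell2[of y]]])
    (rule norm_cinner_le)

instance
proof
  fix x y z :: "'a ell2" and a b :: complex and r s :: real
  show "x + y + z = x + (y + z)" "x + y = y + x" "0 + x = x" "- x + x = 0" "x - y = x + - y"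
    by (transfer; simp add: algebra_simps)+
  show "r *\<^sub>R (x + y) = r *\<^sub>R x + r *\<^sub>R y" "(r + s) *\<^sub>R x = r *\<^sub>R x + s *\<^sub>R x"
    "r *\<^sub>R s *\<^sub>R x = (r * s) *\<^sub>R x" "1 *\<^sub>R x = x"
    by (transfer; simp add: algebra_simps)+
  show "a *\<^sub>C (x + y) = a *\<^sub>C x + a *\<^sub>C y" "(a + b) *\<^sub>C x = a *\<^sub>C x + b *\<^sub>C x"
    "a *\<^sub>C b *\<^sub>C x = (a * b) *\<^sub>C x" "complex_of_real r *\<^sub>C x = r *\<^sub>R x"
    by (transfer; simp add: scaleC_add_right scaleC_add_left scaleC_scaleC scaleC_of_real)+
  show "sgn x = scaleR (inverse (norm x)) x" by (rule sgn_ell2_def)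
  show "dist x y = norm (x - y)" by (rule dist_ell2_def)
  show "uniformity = (INF e\<in>{0<..}. principal {(x, y::'a ell2). dist x y < e})"
    by (rule uniformity_ell2_def)
  show "open S = (\<forall>x\<in>S. \<forall>\<^sub>F (x', y) in uniformity. x' = x \<longrightarrow> y \<in> S)" for S :: "'a ell2 set"
    by (rule open_ell2_def)
  show "norm x = sqrt (inner x x)" by (rule norm_ell2_def)
  show "inner x y = inner y x"
    by (simp add: inner_ell2_def inner_commute)
  show "inner (x + y) z = inner x z + inner y z"
    by (simp add: inner_ell2_def plus_ell2.rep_eq inner_add_left
        suminf_add[OF summable_inner_ell2 summable_inner_ell2])
  show "inner (r *\<^sub>R x) y = r * inner x y"
    by (simp add: inner_ell2_def scaleR_ell2.rep_eq suminf_mult[OF summable_inner_ell2])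
  show "0 \<le> inner x x"
    unfolding inner_ell2_def by (intro suminf_nonneg summable_inner_ell2) simp
  show "inner x x = 0 \<longleftrightarrow> x = 0"
  proof
    assume "inner x x = 0"
    then have "\<forall>n. inner (ell2_nth x n) (ell2_nth x n) = 0"
      unfolding inner_ell2_def by (subst (asm) suminf_eq_zero_iff[OF summable_inner_ell2]) auto
    then show "x = 0"
      by (intro ell2_eqI) (simp add: zero_ell2.rep_eq)
  qed (simp add: inner_ell2_def zero_ell2.rep_eq)
  show "cinner (x + y) z = cinner x z + cinner y z"
    by (simp add: cinner_ell2_def plus_ell2.rep_eq cinner_add_left
        suminf_add[OF summable_cinner_ell2 summable_cinner_ell2])
  show "cinner (a *\<^sub>C x) y = a * cinner x y"
    by (simp add: cinner_ell2_def scaleC_ell2.rep_eq cinner_scaleC_left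
        suminf_mult[OF summable_cinner_ell2])
  have "(\<lambda>n. cinner (ell2_nth y n) (ell2_nth x n)) sums cinner y x"
    using summable_sums[OF summable_cinner_ell2] by (simp add: cinner_ell2_def)
  then have "(\<lambda>n. cnj (cinner (ell2_nth y n) (ell2_nth x n))) sums cnj (cinner y x)"
    by (simp only: sums_cnj)
  then have "(\<lambda>n. cinner (ell2_nth x n) (ell2_nth y n)) sums cnj (cinner y x)"
    by (simp add: cinner_commute[symmetric])
  then show "cinner x y = cnj (cinner y x)"
    by (simp add: cinner_ell2_def sums_iff)
  show "Re (cinner x y) = inner x y"
    by (simp add: cinner_ell2_def inner_ell2_def Re_suminf[OF summable_cinner_ell2] Re_cinner)
qed

end

lemma norm_ell2_sq: "(norm x)\<^sup>2 = (\<Sum>n. (norm (ell2_nth x n))\<^sup>2)"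
  by (simp add: power2_norm_eq_inner inner_ell2_def)

lemma sum_norm_ell2_le: "(\<Sum>n\<in>I. (norm (ell2_nth x n))\<^sup>2) \<le> (norm x)\<^sup>2" if "finite I"
  unfolding norm_ell2_sq by (intro sum_le_suminf summable_ell2 that) simp

lemma norm_ell2_nth_le: "norm (ell2_nth x n) \<le> norm x"
  using sum_norm_ell2_le[of "{n}" x] by (simp add: power2_le_iff_abs_le)

instance ell2 :: (complex_hilbert) complex_hilbert
proof
  fix X :: "nat \<Rightarrow> 'a ell2"
  assume X: "Cauchy X"
  have "Cauchy (\<lambda>m. ell2_nth (X m) n)" for n
  proof (rule CauchyI)
    fix e :: real
    assume "0 < e"
    then obtain M where M: "\<And>m k. m \<ge> M \<Longrightarrow> k \<ge> M \<Longrightarrow> norm (X m - X k) < e"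
      using CauchyD[OF X] by blast
    have "norm (ell2_nth (X m) n - ell2_nth (X k) n) < e" if "m \<ge> M" "k \<ge> M" for m k
      using norm_ell2_nth_le[of "X m - X k" n] M[OF that] by (simp add: minus_ell2.rep_eq)
    then show "\<exists>M. \<forall>m\<ge>M. \<forall>k\<ge>M. norm (ell2_nth (X m) n - ell2_nth (X k) n) < e"
      by blast
  qed
  then have "\<forall>n. \<exists>l. (\<lambda>m. ell2_nth (X m) n) \<longlonglongrightarrow> l"
    by (simp add: Cauchy_convergent_iff convergent_def)
  then obtain L where L: "\<And>n. (\<lambda>m. ell2_nth (X m) n) \<longlonglongrightarrow> L n"
    using choice[of "\<lambda>n l. (\<lambda>m. ell2_nth (X m) n) \<longlonglongrightarrow> l"] by blast
  have tail: "\<exists>M. \<forall>m\<ge>M. \<forall>K. (\<Sum>n<K. (norm (ell2_nth (X m) n - L n))\<^sup>2) \<le> e\<^sup>2"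
    if e: "0 < e" for e :: real
  proof -
    obtain M where M: "\<And>m k. m \<ge> M \<Longrightarrow> k \<ge> M \<Longrightarrow> norm (X m - X k) < e"
      using CauchyD[OF X e] by blast
    have "(\<Sum>n<K. (norm (ell2_nth (X m) n - L n))\<^sup>2) \<le> e\<^sup>2" if m: "m \<ge> M" for m K
    proof (rule LIMSEQ_le_const2)
      show "(\<lambda>k. \<Sum>n<K. (norm (ell2_nth (X m) n - ell2_nth (X k) n))\<^sup>2)
          \<longlonglongrightarrow> (\<Sum>n<K. (norm (ell2_nth (X m) n - L n))\<^sup>2)"
        by (intro tendsto_intros L)
      have "(\<Sum>n<K. (norm (ell2_nth (X m) n - ell2_nth (X k) n))\<^sup>2) \<le> e\<^sup>2" if "k \<ge> M" for k
      proof -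
        have "(\<Sum>n<K. (norm (ell2_nth (X m) n - ell2_nth (X k) n))\<^sup>2) \<le> (norm (X m - X k))\<^sup>2"
          using sum_norm_ell2_le[of "{..<K}" "X m - X k"] by (simp add: minus_ell2.rep_eq)
        also have "\<dots> \<le> e\<^sup>2"
          using M[OF m that] by (intro power_mono) auto
        finally show ?thesis .
      qed
      then show "\<exists>N. \<forall>k\<ge>N. (\<Sum>n<K. (norm (ell2_nth (X m) n - ell2_nth (X k) n))\<^sup>2) \<le> e\<^sup>2"
        by blast
    qed
    then show ?thesis by blast
  qed
  have sq_summable: "summable (\<lambda>n. (norm (ell2_nth (X m) n - L n))\<^sup>2)"
    if "\<forall>K. (\<Sum>n<K. (norm (ell2_nth (X m) n - L n))\<^sup>2) \<le> e\<^sup>2" for m and e :: real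
    using that by (intro summableI_nonneg_bounded[of _ "e\<^sup>2"]) auto
  obtain m where "\<forall>K. (\<Sum>n<K. (norm (ell2_nth (X m) n - L n))\<^sup>2) \<le> 1\<^sup>2"
    using tail[of 1] by auto
  from sq_summable[OF this] have "summable (\<lambda>n. (norm (L n - ell2_nth (X m) n))\<^sup>2)"
    by (simp add: norm_minus_commute)
  from summable_norm_add_sq[OF this summable_ell2[of "X m"]]
  have "summable (\<lambda>n. (norm (L n))\<^sup>2)" by simp
  then obtain l where l: "\<And>n. ell2_nth l n = L n"
    using Abs_ell2_inverse[of L] by (metis mem_Collect_eq)
  have "X \<longlonglongrightarrow> l"
  proof (rule LIMSEQ_I)
    fix e :: real
    assume "0 < e"
    then obtain M where
      M: "\<And>m. m \<ge> M \<Longrightarrow> \<forall>K. (\<Sum>n<K. (norm (ell2_nth (X m) n - L n))\<^sup>2) \<le> (e / 2)\<^sup>2"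
      using tail[of "e / 2"] by auto
    have "norm (X m - l) < e" if "m \<ge> M" for m
    proof -
      have "(norm (X m - l))\<^sup>2 = (\<Sum>n. (norm (ell2_nth (X m) n - L n))\<^sup>2)"
        by (simp add: norm_ell2_sq minus_ell2.rep_eq l)
      also have "\<dots> \<le> (e / 2)\<^sup>2"
        using M[OF that] by (intro suminf_le_const sq_summable) auto
      finally have "norm (X m - l) \<le> e / 2"
        using \<open>0 < e\<close> by (simp add: power2_le_iff_abs_le)
      with \<open>0 < e\<close> show ?thesis by simp
    qed
    then show "\<exists>M. \<forall>m\<ge>M. norm (X m - l) < e" by blast
  qed
  then show "convergent X" by (rule convergentI)
qed

lift_definition ell2_cons :: "'a::complex_inner \<Rightarrow> 'a ell2 \<Rightarrow> 'a ell2"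
  is "\<lambda>a f. case_nat a f"
proof -
  fix a :: 'a and f :: "nat \<Rightarrow> 'a"
  assume "summable (\<lambda>n. (norm (f n))\<^sup>2)"
  then show "summable (\<lambda>n. (norm (case_nat a f n))\<^sup>2)"
    by (subst summable_Suc_iff[symmetric]) simp
qed

lift_definition ell2_tail :: "'a::complex_inner ell2 \<Rightarrow> 'a ell2"
  is "\<lambda>f n. f (Suc n)"
  by (subst summable_Suc_iff)


section \<open>Subspaces and operators\<close>

definition closed_csubspace :: "'a::complex_inner set \<Rightarrow> bool"
  where "closed_csubspace M \<longleftrightarrow> csubspace M \<and> closed M"

definition orth_compl :: "'a::complex_inner set \<Rightarrow> 'a set"
  where "orth_compl M = {x. \<forall>m\<in>M. cinner x m = 0}"

text \<open>The projection is meaningful for closed subspaces of a Hilbert space and the adjoint for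
  bounded operators between Hilbert spaces; the descriptions below are then uniquely satisfied.\<close>

definition orth_proj :: "'a::complex_inner set \<Rightarrow> 'a \<Rightarrow> 'a"
  where "orth_proj M x = (THE y. y \<in> M \<and> x - y \<in> orth_compl M)"

definition bounded_clinear_on ::
    "'a::complex_inner set \<Rightarrow> 'b::complex_inner set \<Rightarrow> ('a \<Rightarrow> 'b) \<Rightarrow> bool"
  where "bounded_clinear_on M N A \<longleftrightarrow>
    (\<forall>x\<in>M. A x \<in> N) \<and>
    (\<forall>x\<in>M. \<forall>y\<in>M. A (x + y) = A x + A y) \<and>
    (\<forall>c. \<forall>x\<in>M. A (c *\<^sub>C x) = c *\<^sub>C A x) \<and>
    (\<exists>B. \<forall>x\<in>M. norm (A x) \<le> B * norm x)"

abbreviation bounded_clinear :: "('a::complex_inner \<Rightarrow> 'b::complex_inner) \<Rightarrow> bool"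
  where "bounded_clinear \<equiv> bounded_clinear_on UNIV UNIV"

definition cadjoint :: "('a::complex_inner \<Rightarrow> 'b::complex_inner) \<Rightarrow> 'b \<Rightarrow> 'a"
  where "cadjoint A = (THE B. \<forall>x y. cinner (A x) y = cinner x (B y))"

definition contraction_on :: "'a::complex_inner set \<Rightarrow> ('a \<Rightarrow> 'a) \<Rightarrow> bool"
  where "contraction_on M A \<longleftrightarrow> bounded_clinear_on M M A \<and> (\<forall>x\<in>M. norm (A x) \<le> norm x)"

definition unitary_on :: "'a::complex_inner set \<Rightarrow> ('a \<Rightarrow> 'a) \<Rightarrow> bool"
  where "unitary_on M A \<longleftrightarrow>
    bounded_clinear_on M M A \<and> (\<forall>x\<in>M. norm (A x) = norm x) \<and> A ` M = M"


section \<open>Linear pencils and dilations\<close>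

text \<open>All Hilbert spaces occurring in a dilation are closed subspaces of one ambient space.
  An operator on a subspace \<open>M\<close> is a function on the ambient space of which only the
  restriction to \<open>M\<close> matters.\<close>

abbreviation unit_circle :: "complex set"
  where "unit_circle \<equiv> sphere 0 1"

definition pencil :: "('a \<Rightarrow> 'b::complex_inner) \<Rightarrow> ('a \<Rightarrow> 'b) \<Rightarrow> complex \<Rightarrow> 'a \<Rightarrow> 'b"
  where "pencil A\<^sub>0 A\<^sub>1 \<mu> x = A\<^sub>0 x + \<mu> *\<^sub>C A\<^sub>1 x"

definition linear_pencil :: "'a::complex_inner set \<Rightarrow> (complex \<Rightarrow> 'a \<Rightarrow> 'a) \<Rightarrow> bool"
  where "linear_pencil M T \<longleftrightarrow>
    (\<exists>T\<^sub>0 T\<^sub>1. bounded_clinear_on M M T\<^sub>0 \<and> bounded_clinear_on M M T\<^sub>1 \<and>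
      (\<forall>\<mu>\<in>unit_circle. \<forall>x\<in>M. T \<mu> x = pencil T\<^sub>0 T\<^sub>1 \<mu> x))"

definition contractive_pencil :: "'a::complex_inner set \<Rightarrow> (complex \<Rightarrow> 'a \<Rightarrow> 'a) \<Rightarrow> bool"
  where "contractive_pencil M T \<longleftrightarrow>
    linear_pencil M T \<and> (\<forall>\<mu>\<in>unit_circle. contraction_on M (T \<mu>))"

definition unitary_pencil :: "'a::complex_inner set \<Rightarrow> (complex \<Rightarrow> 'a \<Rightarrow> 'a) \<Rightarrow> bool"
  where "unitary_pencil M T \<longleftrightarrow>
    linear_pencil M T \<and> (\<forall>\<mu>\<in>unit_circle. unitary_on M (T \<mu>))"

text \<open>In the following predicates \<open>T\<close> is the given pencil on \<open>H\<close> and \<open>W\<close> its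
  candidate dilation on \<open>K\<close>.\<close>

definition dilation ::
    "'a::complex_hilbert set \<Rightarrow> (complex \<Rightarrow> 'a \<Rightarrow> 'a) \<Rightarrow> 'a set \<Rightarrow> (complex \<Rightarrow> 'a \<Rightarrow> 'a) \<Rightarrow> bool"
  where "dilation H T K W \<longleftrightarrow>
    closed_csubspace H \<and> closed_csubspace K \<and> H \<subseteq> K \<and> linear_pencil H T \<and> linear_pencil K W \<and>
    (\<forall>\<mu>\<in>unit_circle. \<forall>n. \<forall>x\<in>H. (T \<mu> ^^ n) x = orth_proj H ((W \<mu> ^^ n) x))"

text \<open>The value \<open>foldr T [\<mu>\<^sub>1, \<dots>, \<mu>\<^sub>n] x\<close> is
  \<open>T \<mu>\<^sub>1 (\<dots> (T \<mu>\<^sub>n x))\<close>; the empty list contributes only the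
  trivial identity for \<open>n = 0\<close>.\<close>

definition uniform_dilation ::
    "'a::complex_hilbert set \<Rightarrow> (complex \<Rightarrow> 'a \<Rightarrow> 'a) \<Rightarrow> 'a set \<Rightarrow> (complex \<Rightarrow> 'a \<Rightarrow> 'a) \<Rightarrow> bool"
  where "uniform_dilation H T K W \<longleftrightarrow>
    dilation H T K W \<and>
    (\<forall>ms. set ms \<subseteq> unit_circle \<longrightarrow>
      (\<forall>x\<in>H. foldr T ms x = orth_proj H (foldr W ms x)))"

definition unitary_dilation ::
    "'a::complex_hilbert set \<Rightarrow> (complex \<Rightarrow> 'a \<Rightarrow> 'a) \<Rightarrow> 'a set \<Rightarrow> (complex \<Rightarrow> 'a \<Rightarrow> 'a) \<Rightarrow> bool"
  where "unitary_dilation H T K W \<longleftrightarrow> dilation H T K W \<and> unitary_pencil K W"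

definition uniform_unitary_dilation ::
    "'a::complex_hilbert set \<Rightarrow> (complex \<Rightarrow> 'a \<Rightarrow> 'a) \<Rightarrow> 'a set \<Rightarrow> (complex \<Rightarrow> 'a \<Rightarrow> 'a) \<Rightarrow> bool"
  where "uniform_unitary_dilation H T K W \<longleftrightarrow> uniform_dilation H T K W \<and> unitary_pencil K W"

definition compression ::
    "'a::complex_inner set \<Rightarrow> (complex \<Rightarrow> 'a \<Rightarrow> 'a) \<Rightarrow> complex \<Rightarrow> 'a \<Rightarrow> 'a"
  where "compression M W \<mu> x = orth_proj M (W \<mu> x)"

definition minimal_unitary_dilation ::
    "'a::complex_hilbert set \<Rightarrow> (complex \<Rightarrow> 'a \<Rightarrow> 'a) \<Rightarrow> 'a set \<Rightarrow> (complex \<Rightarrow> 'a \<Rightarrow> 'a) \<Rightarrow> bool"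
  where "minimal_unitary_dilation H T K W \<longleftrightarrow>
    unitary_dilation H T K W \<and>
    (\<forall>M. closed_csubspace M \<and> H \<subseteq> M \<and> M \<subseteq> K \<and> unitary_dilation H T M (compression M W)
      \<longrightarrow> M = K)"

definition minimal_uniform_unitary_dilation ::
    "'a::complex_hilbert set \<Rightarrow> (complex \<Rightarrow> 'a \<Rightarrow> 'a) \<Rightarrow> 'a set \<Rightarrow> (complex \<Rightarrow> 'a \<Rightarrow> 'a) \<Rightarrow> bool"
  where "minimal_uniform_unitary_dilation H T K W \<longleftrightarrow>
    uniform_unitary_dilation H T K W \<and>
    (\<forall>M. closed_csubspace M \<and> H \<subseteq> M \<and> M \<subseteq> K \<and>
      uniform_unitary_dilation H T M (compression M W) \<longrightarrow> M = K)"


section \<open>Hardy spaces and outer functions\<close>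

text \<open>Complex differentiability of a vector-valued function: the real derivative is
  multiplication of a fixed vector by complex scalars.\<close>

definition vec_holomorphic_on :: "(complex \<Rightarrow> 'a::complex_inner) \<Rightarrow> complex set \<Rightarrow> bool"
  where "vec_holomorphic_on f S \<longleftrightarrow>
    (\<forall>z\<in>S. \<exists>D. (f has_derivative (\<lambda>h. h *\<^sub>C D)) (at z within S))"

definition op_holomorphic_on ::
    "(complex \<Rightarrow> 'a::complex_inner \<Rightarrow> 'b::complex_inner) \<Rightarrow> complex set \<Rightarrow> bool"
  where "op_holomorphic_on \<theta> S \<longleftrightarrow>
    (\<forall>z\<in>S. bounded_clinear (\<theta> z)) \<and>
    (\<forall>z\<in>S. \<exists>D. bounded_clinear D \<and>
      ((\<lambda>w. onorm (\<lambda>x. inverse (w - z) *\<^sub>C (\<theta> w x - \<theta> z x) - D x)) \<longlongrightarrow> 0) (at z within S))"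

definition circle_mean :: "(complex \<Rightarrow> 'a::complex_inner) \<Rightarrow> real \<Rightarrow> real"
  where "circle_mean f r =
    integral {0..2 * pi} (\<lambda>s. (norm (f (complex_of_real r * cis s)))\<^sup>2) / (2 * pi)"

text \<open>Only the values on the open unit disk of a member of the Hardy space matter.\<close>

definition hardy2 :: "(complex \<Rightarrow> 'a::complex_inner) set"
  where "hardy2 =
    {f. vec_holomorphic_on f (ball 0 1) \<and> bdd_above (circle_mean f ` {0<..<1})}"

definition hardy_norm :: "(complex \<Rightarrow> 'a::complex_inner) \<Rightarrow> real"
  where "hardy_norm f = sqrt (SUP r\<in>{0<..<1}. circle_mean f r)"

definition outer ::
    "(complex \<Rightarrow> 'a::complex_hilbert \<Rightarrow> 'b::complex_hilbert) \<Rightarrow> bool"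
  where "outer \<theta> \<longleftrightarrow>
    op_holomorphic_on \<theta> (ball 0 1) \<and>
    (\<forall>z\<in>ball 0 1. \<forall>x. norm (\<theta> z x) \<le> norm x) \<and>
    (\<forall>g\<in>hardy2. \<forall>\<epsilon>>0. \<exists>f\<in>hardy2. hardy_norm (\<lambda>z. \<theta> z (f z) - g z) < \<epsilon>)"


section \<open>The model dilation\<close>

text \<open>The space \<open>\<KK>\<^sub>+\<close> is the type \<open>'y ell2 \<times> 'h\<close>, the
  \<open>n\<close>-th entry of the sequence sitting in the \<open>(- n - 1)\<close>-st copy of \<open>\<YY>\<close>.\<close>

type_synonym ('y, 'h) Kplus = "'y ell2 \<times> 'h"

definition comp_Y :: "('y::complex_hilbert, 'h::complex_hilbert) Kplus \<Rightarrow> 'y"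
  where "comp_Y x = ell2_nth (fst x) 0"

definition comp_H :: "('y::complex_hilbert, 'h::complex_hilbert) Kplus \<Rightarrow> 'h"
  where "comp_H x = snd x"

context
  fixes T\<^sub>0 T\<^sub>1 :: "'h::complex_hilbert \<Rightarrow> 'h"
    and F\<^sub>0 F\<^sub>1 :: "'h \<Rightarrow> 'y::complex_hilbert"
begin

definition model_V :: "complex \<Rightarrow> ('y, 'h) Kplus \<Rightarrow> ('y, 'h) Kplus"
  where "model_V \<mu> = (\<lambda>(y, h). (ell2_cons (pencil F\<^sub>0 F\<^sub>1 \<mu> h) y, pencil T\<^sub>0 T\<^sub>1 \<mu> h))"

definition model_V\<^sub>0 :: "('y, 'h) Kplus \<Rightarrow> ('y, 'h) Kplus"
  where "model_V\<^sub>0 = (\<lambda>(y, h). (ell2_cons (F\<^sub>0 h) y, T\<^sub>0 h))"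

definition model_V\<^sub>1 :: "('y, 'h) Kplus \<Rightarrow> ('y, 'h) Kplus"
  where "model_V\<^sub>1 = (\<lambda>(y, h). (ell2_cons (F\<^sub>1 h) 0, T\<^sub>1 h))"

lemma model_V_pencil: "model_V \<mu> = pencil model_V\<^sub>0 model_V\<^sub>1 \<mu>"
proof -
  have "ell2_cons (a + \<mu> *\<^sub>C b) y = ell2_cons a y + \<mu> *\<^sub>C ell2_cons b 0" for a b and y :: "'y ell2"
    by (rule ell2_eqI)
      (simp add: ell2_cons.rep_eq plus_ell2.rep_eq scaleC_ell2.rep_eq zero_ell2.rep_eq
        split: nat.split)
  then show ?thesis
    by (auto simp: model_V_def model_V\<^sub>0_def model_V\<^sub>1_def pencil_def scaleC_prod_def)
qed

definition space_V :: "('y, 'h) Kplus set"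
  where "space_V = closure (cspan (\<Union>\<mu>\<in>unit_circle. range (model_V \<mu>)))"

definition space_L :: "('y, 'h) Kplus set"
  where "space_L = orth_compl space_V"

definition space_Kc :: "complex \<Rightarrow> ('y, 'h) Kplus set"
  where "space_Kc \<mu> = space_V \<inter> orth_compl (range (model_V \<mu>))"

definition model_P :: "complex \<Rightarrow> ('y, 'h) Kplus \<Rightarrow> ('y, 'h) Kplus"
  where "model_P \<mu> x =
    orth_proj (closure (range model_V\<^sub>0)) x + \<mu> *\<^sub>C orth_proj (closure (range model_V\<^sub>1)) x"

text \<open>The Hilbert sum of \<open>space_Kc 1\<close> and \<open>space_L\<close> is the set of pairs, with
  the norm of the product type.\<close>

definition space_U :: "(('y, 'h) Kplus \<times> ('y, 'h) Kplus) set"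
  where "space_U = space_Kc 1 \<times> space_L"

definition model_Q :: "complex \<Rightarrow> ('y, 'h) Kplus \<times> ('y, 'h) Kplus \<Rightarrow> ('y, 'h) Kplus"
  where "model_Q \<mu> = (\<lambda>(k, l). model_P \<mu> k + l)"

text \<open>The space \<open>\<KK>\<close> consists of the pairs of an element of \<open>\<KK>\<^sub>+\<close> and a
  sequence with entries in \<open>space_U\<close>; the entry of index \<open>n\<close> sits in copy \<open>n + 1\<close>.\<close>

definition space_K ::
    "(('y, 'h) Kplus \<times> (('y, 'h) Kplus \<times> ('y, 'h) Kplus) ell2) set"
  where "space_K = {(x, u). \<forall>n. ell2_nth u n \<in> space_U}"

definition model_U ::
    "complex \<Rightarrow> ('y, 'h) Kplus \<times> (('y, 'h) Kplus \<times> ('y, 'h) Kplus) ell2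
      \<Rightarrow> ('y, 'h) Kplus \<times> (('y, 'h) Kplus \<times> ('y, 'h) Kplus) ell2"
  where "model_U \<mu> = (\<lambda>((y, h), u).
    ((ell2_cons (pencil F\<^sub>0 F\<^sub>1 \<mu> h + comp_Y (model_Q \<mu> (ell2_nth u 0))) y,
      pencil T\<^sub>0 T\<^sub>1 \<mu> h + comp_H (model_Q \<mu> (ell2_nth u 0))),
     ell2_tail u))"

end

text \<open>The copy of \<open>\<HH>\<close> in \<open>\<KK>\<close>, and the pencil on \<open>\<HH>\<close> carried
  over to that copy.\<close>

definition embed_H ::
    "'h::complex_hilbert \<Rightarrow>
      ('y::complex_hilbert, 'h) Kplus \<times> (('y, 'h) Kplus \<times> ('y, 'h) Kplus) ell2"
  where "embed_H h = ((0, h), 0)"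

definition copy_pencil ::
    "(complex \<Rightarrow> 'h \<Rightarrow> 'h) \<Rightarrow> complex
      \<Rightarrow> ('y::complex_hilbert, 'h::complex_hilbert) Kplus \<times> (('y, 'h) Kplus \<times> ('y, 'h) Kplus) ell2
      \<Rightarrow> ('y, 'h) Kplus \<times> (('y, 'h) Kplus \<times> ('y, 'h) Kplus) ell2"
  where "copy_pencil T \<mu> x = embed_H (T \<mu> (comp_H (fst x)))"

end

theory Submission
  imports Defs
begin

text \<open>The operator \<open>P \<mu>\<close> is unitary on \<open>VV\<close> and carries \<open>V 1\<close> to \<open>V \<mu>\<close>, hence it carries
  \<open>VV \<ominus> V 1 K\<^sub>+\<close> onto \<open>VV \<ominus> V \<mu> K\<^sub>+\<close>; so \<open>Q \<mu>\<close> is isometric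
  from the auxiliary space onto the complement of \<open>V \<mu> K\<^sub>+\<close>, which makes \<open>U \<mu>\<close> unitary.

  For minimality, a compression of \<open>U \<mu>\<close> to \<open>M\<close> that is unitary on \<open>M\<close> forces
  \<open>U \<mu> M = M\<close>.  If \<open>M\<close> contains \<open>H\<close>, then it contains \<open>F \<mu> h = U \<mu> h - T \<mu> h\<close>, and these
  vectors span the last copy of \<open>Y\<close> because \<open>F\<close> is outer; shifting by \<open>U \<mu>\<close> gives the other
  copies, so \<open>M\<close> contains \<open>K\<^sub>+\<close>.  Since \<open>U 1\<close> maps the first auxiliary copy into \<open>K\<^sub>+\<close> and
  each further one onto its predecessor, \<open>M\<close> contains these copies as well.  Unitarity at the
  individual \<open>\<mu>\<close> is all that is used, so both minimality claims follow at once.\<close>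

section \<open>Complex Hilbert spaces\<close>

lemma cinner_add_right: "cinner x (y + z) = cinner x y + cinner x (z :: 'a::complex_inner)"
  by (metis cinner_commute cinner_add_left complex_cnj_add)

lemma bounded_bilinear_cinner: "bounded_bilinear (cinner :: 'a::complex_inner \<Rightarrow> _)"
proof
  fix a a' b b' :: 'a and r :: real
  show "cinner (r *\<^sub>R a) b = r *\<^sub>R cinner a b"
    by (simp add: scaleC_of_real[symmetric] cinner_scaleC_left scaleR_conv_of_real)
  show "cinner a (r *\<^sub>R b) = r *\<^sub>R cinner a b"
    by (simp add: scaleC_of_real[symmetric] cinner_scaleC_right scaleR_conv_of_real)
  show "\<exists>K. \<forall>a b::'a. norm (cinner a b) \<le> norm a * norm b * K"
    by (rule exI[of _ 1]) (simp add: norm_cinner_le)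
qed (simp_all add: cinner_add_left cinner_add_right)

interpretation cinner: bounded_bilinear "cinner :: 'a::complex_inner \<Rightarrow> _"
  by (rule bounded_bilinear_cinner)

lemma bounded_bilinear_scaleC: "bounded_bilinear (scaleC :: complex \<Rightarrow> 'a::complex_inner \<Rightarrow> 'a)"
proof
  fix a :: complex and b :: 'a and r :: real
  show "(r *\<^sub>R a) *\<^sub>C b = r *\<^sub>R a *\<^sub>C b"
    by (simp add: scaleC_of_real[symmetric] scaleC_scaleC scaleR_conv_of_real)
  show "a *\<^sub>C r *\<^sub>R b = r *\<^sub>R a *\<^sub>C b"
    by (simp add: scaleC_of_real[symmetric] scaleC_scaleC mult.commute)
  show "\<exists>K. \<forall>a (b::'a). norm (a *\<^sub>C b) \<le> norm a * norm b * K"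
    by (rule exI[of _ 1]) (simp add: norm_scaleC)
qed (simp_all add: scaleC_add_left scaleC_add_right)

interpretation scaleC: bounded_bilinear "scaleC :: complex \<Rightarrow> 'a::complex_inner \<Rightarrow> 'a"
  by (rule bounded_bilinear_scaleC)

lemmas scaleC_simps [simp] = scaleC.zero_left scaleC.zero_right scaleC_one
lemmas cinner_zero [simp] = cinner.zero_left cinner.zero_right

text \<open>Conjugate linearity turns \<open>\<i>\<close> into the factor \<open>- \<i>\<close>,
  which moves the imaginary part to the real part. This upgrades real orthogonality to a complex
  subspace to complex orthogonality.\<close>

lemma Im_cinner: "Im (cinner x y) = inner x (\<i> *\<^sub>C (y :: 'a::complex_inner))"
  by (simp add: Re_cinner[symmetric] cinner_scaleC_right)

lemma cinner_eq_0_commute: "cinner x y = 0 \<longleftrightarrow> cinner y (x :: 'a::complex_inner) = 0"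
  by (metis cinner_commute complex_cnj_zero_iff)

lemma cinner_self_eq_0 [simp]: "cinner x x = 0 \<longleftrightarrow> x = (0 :: 'a::complex_inner)"
  by (simp add: cinner_self)

lemma inner_eq_0_if_cinner: "cinner x y = 0 \<Longrightarrow> inner x (y :: 'a::complex_inner) = 0"
  by (simp add: Re_cinner[symmetric])

lemma norm_add_sq_orth:
  "(norm (x + y))\<^sup>2 = (norm x)\<^sup>2 + (norm y)\<^sup>2" if "cinner x y = 0" for x y :: "'a::complex_inner"
  using inner_eq_0_if_cinner[OF that]
  by (simp add: power2_norm_eq_inner inner_add_left inner_add_right inner_commute)

section \<open>Bounded complex linear maps\<close>

lemma bounded_clinear_onI:
  assumes "\<And>x. x \<in> M \<Longrightarrow> A x \<in> N"
    and "\<And>x y. x \<in> M \<Longrightarrow> y \<in> M \<Longrightarrow> A (x + y) = A x + A y"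
    and "\<And>c x. x \<in> M \<Longrightarrow> A (c *\<^sub>C x) = c *\<^sub>C A x"
    and "\<And>x. x \<in> M \<Longrightarrow> norm (A x) \<le> K * norm x"
  shows "bounded_clinear_on M N A"
  using assms unfolding bounded_clinear_on_def by blast

lemma bounded_clinear_onD:
  assumes "bounded_clinear_on M N A"
  shows "x \<in> M \<Longrightarrow> A x \<in> N" "x \<in> M \<Longrightarrow> y \<in> M \<Longrightarrow> A (x + y) = A x + A y"
    "x \<in> M \<Longrightarrow> A (c *\<^sub>C x) = c *\<^sub>C A x"
  using assms unfolding bounded_clinear_on_def by auto

lemma bounded_clinear_imp_bounded_linear:
  assumes "bounded_clinear A" shows "bounded_linear A"
proof -
  obtain B where "\<And>x. norm (A x) \<le> B * norm x"
    using assms unfolding bounded_clinear_on_def by auto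
  then show ?thesis
    using bounded_clinear_onD[OF assms]
    by (intro bounded_linear_intro[of _ B]) (simp_all add: mult.commute scaleC_of_real[symmetric])
qed

text \<open>Composite operators are shown to be bounded as real linear maps first; complex
  homogeneity is then checked separately.\<close>

lemma bounded_clinear_iff:
  "bounded_clinear A \<longleftrightarrow> bounded_linear A \<and> (\<forall>c x. A (c *\<^sub>C x) = c *\<^sub>C A x)"
proof (rule iffI)
  assume "bounded_clinear A"
  then show "bounded_linear A \<and> (\<forall>c x. A (c *\<^sub>C x) = c *\<^sub>C A x)"
    by (simp add: bounded_clinear_imp_bounded_linear bounded_clinear_on_def)
next
  assume A: "bounded_linear A \<and> (\<forall>c x. A (c *\<^sub>C x) = c *\<^sub>C A x)"
  obtain K where "\<And>x. norm (A x) \<le> norm x * K"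
    using bounded_linear.bounded[OF conjunct1[OF A]] by blast
  then show "bounded_clinear A"
    using A linear_add[OF bounded_linear.linear[OF conjunct1[OF A]]]
    unfolding bounded_clinear_on_def by (auto simp: mult.commute)
qed

lemma bounded_clinear_on_invariant:
  assumes "bounded_clinear A" "\<And>x. x \<in> M \<Longrightarrow> A x \<in> M" shows "bounded_clinear_on M M A"
proof -
  obtain K where "\<forall>x. norm (A x) \<le> K * norm x"
    using assms(1) unfolding bounded_clinear_on_def by blast
  then show ?thesis
    by (intro bounded_clinear_onI[of M A M K]) (simp_all add: assms(2) bounded_clinear_onD[OF assms(1)])
qed

lemma bounded_clinear_pencil:
  assumes "bounded_clinear A\<^sub>0" "bounded_clinear A\<^sub>1"
  shows "bounded_clinear (pencil A\<^sub>0 A\<^sub>1 \<mu>)"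
proof -
  have "bounded_linear (pencil A\<^sub>0 A\<^sub>1 \<mu>)"
    unfolding pencil_def
    by (intro bounded_linear_add bounded_clinear_imp_bounded_linear assms
        scaleC.bounded_linear_right[THEN bounded_linear_compose, unfolded o_def])
  then obtain K where "\<And>x. norm (pencil A\<^sub>0 A\<^sub>1 \<mu> x) \<le> norm x * K"
    using bounded_linear.bounded by blast
  then show ?thesis
    using bounded_clinear_onD[OF assms(1)] bounded_clinear_onD[OF assms(2)]
    unfolding bounded_clinear_on_def pencil_def
    by (auto simp: scaleC_add_right scaleC_scaleC mult.commute algebra_simps)
qed

section \<open>Orthogonal complements and closed subspaces\<close>

lemma csubspace_orth_compl: "csubspace (orth_compl M)"
  unfolding complex_vector.subspace_def orth_compl_def
  by (auto simp: cinner_add_left cinner_scaleC_left)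

lemma closed_orth_compl: "closed (orth_compl (M :: 'a::complex_inner set))"
proof -
  have "orth_compl M = (\<Inter>m\<in>M. {x. cinner x m = 0})"
    by (auto simp: orth_compl_def)
  then show ?thesis
    by (auto intro!: closed_INT closed_Collect_eq
        linear_continuous_on[OF cinner.bounded_linear_left] continuous_on_const)
qed

lemma closed_csubspace_orth_compl: "closed_csubspace (orth_compl M)"
  by (simp add: closed_csubspace_def csubspace_orth_compl closed_orth_compl)

lemma orth_complI: "(\<And>m. m \<in> M \<Longrightarrow> cinner x m = 0) \<Longrightarrow> x \<in> orth_compl M"
  by (simp add: orth_compl_def)

lemma orth_complD: "x \<in> orth_compl M \<Longrightarrow> m \<in> M \<Longrightarrow> cinner x m = 0"
  by (simp add: orth_compl_def)

lemma closed_csubspace_Int: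
  "closed_csubspace M \<Longrightarrow> closed_csubspace N \<Longrightarrow> closed_csubspace (M \<inter> N)"
  by (simp add: closed_csubspace_def complex_vector.subspace_inter closed_Int)

lemma closed_csubspace_Times:
  "closed_csubspace M \<Longrightarrow> closed_csubspace N \<Longrightarrow> closed_csubspace (M \<times> N)"
  by (auto simp: closed_csubspace_def complex_vector.subspace_def scaleC_prod_def zero_prod_def
      intro: closed_Times)

lemma closed_csubspaceD:
  assumes "closed_csubspace M"
  shows "csubspace M" "closed M" "0 \<in> M" "x \<in> M \<Longrightarrow> y \<in> M \<Longrightarrow> x + y \<in> M"
    "x \<in> M \<Longrightarrow> c *\<^sub>C x \<in> M" "x \<in> M \<Longrightarrow> y \<in> M \<Longrightarrow> x - y \<in> M"
  using assms complex_vector.subspace_diff[of M x y]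
  unfolding closed_csubspace_def complex_vector.subspace_def by auto

lemma closed_csubspace_closure:
  fixes M :: "'a::complex_inner set"
  assumes M: "csubspace M" shows "closed_csubspace (closure M)"
proof -
  have "x + y \<in> closure M" if x: "x \<in> closure M" and y: "y \<in> closure M" for x y
  proof -
    obtain a b where "\<And>n. a n \<in> M" "\<And>n. b n \<in> M" "a \<longlonglongrightarrow> x" "b \<longlonglongrightarrow> y"
      using x y unfolding closure_sequential by blast
    then show ?thesis
      unfolding closure_sequential
      by (intro exI[of _ "\<lambda>n. a n + b n"])
        (use M in \<open>auto intro!: tendsto_add simp: complex_vector.subspace_add\<close>)
  qed
  moreover have "c *\<^sub>C x \<in> closure M" if x: "x \<in> closure M" for c x
  proof -
    obtain a where "\<And>n. a n \<in> M" "a \<longlonglongrightarrow> x"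
      using x unfolding closure_sequential by blast
    then show ?thesis
      unfolding closure_sequential
      by (intro exI[of _ "\<lambda>n. c *\<^sub>C a n"])
        (use M in \<open>auto intro!: scaleC.tendsto simp: complex_vector.subspace_scale\<close>)
  qed
  moreover have "0 \<in> closure M"
    using complex_vector.subspace_0[OF M] closure_subset by auto
  ultimately show ?thesis
    by (simp add: closed_csubspace_def complex_vector.subspace_def)
qed

lemma csubspace_range:
  assumes "bounded_clinear A" shows "csubspace (range A)"
proof -
  note A = bounded_clinear_onD[OF assms]
  show ?thesis
    unfolding complex_vector.subspace_def
  proof (intro conjI ballI allI)
    show "0 \<in> range A"
      using A(3)[of 0 0] by (metis UNIV_I rangeI scaleC.zero_left)
    fix x y c assume "x \<in> range A" "y \<in> range A"
    then obtain a b where "x = A a" "y = A b" by auto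
    then have "x + y = A (a + b)" "c *\<^sub>C x = A (c *\<^sub>C a)"
      using A by simp_all
    then show "x + y \<in> range A" "c *\<^sub>C x \<in> range A" by auto
  qed
qed

lemma in_orth_compl_closure:
  fixes M :: "'a::complex_inner set"
  assumes "x \<in> orth_compl M" "m \<in> closure M" shows "cinner x m = 0"
proof -
  have "closed {m. cinner x m = 0}"
    by (intro closed_Collect_eq linear_continuous_on[OF cinner.bounded_linear_right]
        continuous_on_const)
  moreover have "M \<subseteq> {m. cinner x m = 0}"
    using assms(1) by (auto simp: orth_compl_def)
  ultimately show ?thesis
    using assms(2) closure_minimal by blast
qed

section \<open>The projection theorem\<close>

lemma orth_decomposition_exists:
  fixes M :: "'a::complex_hilbert set"
  assumes M: "closed_csubspace M"
  shows "\<exists>y. y \<in> M \<and> x - y \<in> orth_compl M"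
proof -
  note MD = closed_csubspaceD[OF M]
  define d where "d = (INF y\<in>M. (norm (x - y))\<^sup>2)"
  have bdd: "bdd_below ((\<lambda>y. (norm (x - y))\<^sup>2) ` M)"
    by (rule bdd_belowI[of _ 0]) auto
  have d_le: "d \<le> (norm (x - y))\<^sup>2" if "y \<in> M" for y
    unfolding d_def using bdd that by (rule cINF_lower)
  have "\<exists>y\<in>M. (norm (x - y))\<^sup>2 < d + 1 / Suc n" for n
    using cInf_lessD[of "(\<lambda>y. (norm (x - y))\<^sup>2) ` M" "d + 1 / Suc n"] MD(3) unfolding d_def by auto
  then obtain Y where YM: "\<And>n. Y n \<in> M" and Yd: "\<And>n. (norm (x - Y n))\<^sup>2 < d + 1 / Suc n"
    by metis
  \<comment> \<open>Parallelogram law: the midpoint of \<open>y\<close> and \<open>z\<close> lies in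
    \<open>M\<close>, so its squared distance from \<open>x\<close> is at least \<open>d\<close>.
    Hence a minimizing sequence is Cauchy.\<close>
  have par: "(norm (y - z))\<^sup>2 \<le> 2 * ((norm (x - y))\<^sup>2 - d) + 2 * ((norm (x - z))\<^sup>2 - d)"
    if "y \<in> M" "z \<in> M" for y z
  proof -
    have m: "complex_of_real (1/2) *\<^sub>C (y + z) \<in> M" using that MD by blast
    have "(norm (y - z))\<^sup>2 = 2 * (norm (x - y))\<^sup>2 + 2 * (norm (x - z))\<^sup>2
      - 4 * (norm (x - (1/2) *\<^sub>R (y + z)))\<^sup>2"
      by (simp add: power2_norm_eq_inner inner_diff_left inner_diff_right inner_add_left
          inner_add_right inner_commute algebra_simps)
    then show ?thesis
      using d_le[OF m] unfolding scaleC_of_real by simp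
  qed
  have "Cauchy Y"
  proof (rule CauchyI)
    fix e :: real assume e: "0 < e"
    \<comment> \<open>The bound \<open>par\<close> adds two defects, each with factor 2, so each
      must stay below \<open>e\<^sup>2 / 4\<close>.\<close>
    obtain N where N: "inverse (real (Suc N)) < e\<^sup>2 / 4"
      using reals_Archimedean[of "e\<^sup>2 / 4"] e by auto
    have "norm (Y m - Y n) < e" if "m \<ge> N" "n \<ge> N" for m n
    proof -
      have small: "1 / real (Suc k) < e\<^sup>2 / 4" if "k \<ge> N" for k
      proof -
        have "1 / real (Suc k) \<le> inverse (real (Suc N))"
          using that by (simp add: field_simps)
        with N show ?thesis by linarith
      qed
      have "(norm (Y m - Y n))\<^sup>2 < e\<^sup>2"
        using par[OF YM YM, of m n] Yd[of m] Yd[of n] small[OF that(1)] small[OF that(2)]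
        by argo
      then show ?thesis
        using e by (simp add: power2_less_imp_less)
    qed
    then show "\<exists>N. \<forall>m\<ge>N. \<forall>n\<ge>N. norm (Y m - Y n) < e" by blast
  qed
  then obtain y where y: "Y \<longlonglongrightarrow> y"
    using Cauchy_convergent_iff convergent_def by blast
  have yM: "y \<in> M"
    using closed_sequentially[OF MD(2)] YM y by blast
  have "(\<lambda>n. (norm (x - Y n))\<^sup>2) \<longlonglongrightarrow> (norm (x - y))\<^sup>2"
    by (intro tendsto_intros y)
  moreover have "(\<lambda>n. d + 1 / Suc n) \<longlonglongrightarrow> d + 0"
    using LIMSEQ_Suc[OF lim_1_over_n] by (intro tendsto_add tendsto_const)
  ultimately have "(norm (x - y))\<^sup>2 \<le> d + 0"
    by (rule LIMSEQ_le) (intro exI allI impI less_imp_le Yd)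
  then have le: "(norm (x - y))\<^sup>2 \<le> d" by simp
  have real_orth: "inner (x - y) m = 0" if "m \<in> M" for m
  proof (rule ccontr)
    assume ne: "inner (x - y) m \<noteq> 0"
    then have m0: "inner m m > 0" by auto
    \<comment> \<open>The multiple \<open>t\<close> of \<open>m\<close> is the one closest to
      \<open>x - y\<close>; a nonzero \<open>t\<close> would give a point of \<open>M\<close> closer
      to \<open>x\<close> than \<open>y\<close>.\<close>
    define t where "t = inner (x - y) m / inner m m"
    have "y + complex_of_real t *\<^sub>C m \<in> M" using that yM MD by blast
    note d_le[OF this]
    then have "(norm (x - y))\<^sup>2 \<le> (norm ((x - y) - t *\<^sub>R m))\<^sup>2"
      using le unfolding scaleC_of_real diff_diff_eq by linarith
    then have "2 * t * inner (x - y) m \<le> t * t * inner m m"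
      unfolding power2_norm_eq_inner
      by (simp add: inner_diff_left inner_diff_right inner_commute algebra_simps)
    also have "t * t * inner m m = t * inner (x - y) m"
      using m0 by (simp add: t_def)
    finally have "t * inner (x - y) m \<le> 0" by simp
    moreover have "t * inner (x - y) m > 0"
      using m0 ne by (simp add: t_def divide_pos_pos flip: power2_eq_square)
    ultimately show False by simp
  qed
  \<comment> \<open>Testing with \<open>m\<close> and with \<open>\<i> *\<^sub>C m\<close> removes
    the real and the imaginary part.\<close>
  have "cinner (x - y) m = 0" if "m \<in> M" for m
    using real_orth[OF that] real_orth[OF MD(5)[OF that, of \<i>]]
    by (simp add: complex_eq_iff Re_cinner Im_cinner)
  with yM show ?thesis by (auto simp: orth_compl_def)
qed

text \<open>Two candidates differ by a vector of \<open>M\<close> that is orthogonal to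
  \<open>M\<close>, hence to itself.\<close>

lemma orth_proj_eqI:
  fixes M :: "'a::complex_inner set"
  assumes "csubspace M" "y \<in> M" "x - y \<in> orth_compl M"
  shows "orth_proj M x = y"
  unfolding orth_proj_def
proof (rule the_equality)
  fix z assume z: "z \<in> M \<and> x - z \<in> orth_compl M"
  have "(x - y) - (x - z) \<in> orth_compl M"
    using assms z csubspace_orth_compl complex_vector.subspace_diff by blast
  moreover have "z - y \<in> M"
    using assms z complex_vector.subspace_diff by blast
  ultimately have "cinner (z - y) (z - y) = 0"
    by (simp add: orth_compl_def)
  then show "z = y" by simp
qed (use assms in auto)

context
  fixes M :: "'a::complex_hilbert set"
  assumes M: "closed_csubspace M"
begin

lemma orth_proj_in: "orth_proj M x \<in> M"
  and orth_proj_diff: "x - orth_proj M x \<in> orth_compl M"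
  using orth_decomposition_exists[OF M, of x] orth_proj_eqI[of M _ x] closed_csubspaceD(1)[OF M]
  by auto

lemma orth_proj_same: "x \<in> M \<Longrightarrow> orth_proj M x = x"
  by (rule orth_proj_eqI)
    (simp_all add: closed_csubspaceD(1)[OF M] closed_csubspaceD(3)[OF closed_csubspace_orth_compl])

lemma orth_proj_orth: "x \<in> orth_compl M \<Longrightarrow> orth_proj M x = 0"
  by (rule orth_proj_eqI) (use closed_csubspaceD[OF M] in auto)

lemma orth_proj_add: "orth_proj M (x + y) = orth_proj M x + orth_proj M y"
proof (rule orth_proj_eqI)
  have "(x - orth_proj M x) + (y - orth_proj M y) \<in> orth_compl M"
    using closed_csubspaceD(4)[OF closed_csubspace_orth_compl] orth_proj_diff by blast
  then show "x + y - (orth_proj M x + orth_proj M y) \<in> orth_compl M"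
    by (simp add: algebra_simps)
qed (use closed_csubspaceD[OF M] orth_proj_in in auto)

lemma orth_proj_scaleC: "orth_proj M (c *\<^sub>C x) = c *\<^sub>C orth_proj M x"
proof (rule orth_proj_eqI)
  have "c *\<^sub>C (x - orth_proj M x) \<in> orth_compl M"
    using closed_csubspaceD(5)[OF closed_csubspace_orth_compl] orth_proj_diff by blast
  then show "c *\<^sub>C x - c *\<^sub>C orth_proj M x \<in> orth_compl M"
    by (simp add: scaleC.diff_right)
qed (use closed_csubspaceD[OF M] orth_proj_in in auto)

lemma orth_proj_norm_sq: "(norm x)\<^sup>2 = (norm (orth_proj M x))\<^sup>2 + (norm (x - orth_proj M x))\<^sup>2"
proof -
  have "cinner (x - orth_proj M x) (orth_proj M x) = 0"
    using orth_proj_diff orth_proj_in by (rule orth_complD)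
  from norm_add_sq_orth[OF this] show ?thesis by simp
qed

lemma norm_orth_proj_le: "norm (orth_proj M x) \<le> norm x"
  by (rule power2_le_imp_le) (use orth_proj_norm_sq[of x] in auto)

lemma bounded_clinear_orth_proj: "bounded_clinear (orth_proj M)"
  unfolding bounded_clinear_on_def
  by (auto simp: orth_proj_add orth_proj_scaleC intro!: exI[of _ 1] norm_orth_proj_le)

text \<open>By Pythagoras the error of such a projection is zero. In the minimality proof this turns
  an isometric compression into invariance of the subspace.\<close>

lemma mem_if_norm_orth_proj: "x \<in> M" if "norm (orth_proj M x) = norm x"
  using orth_proj_norm_sq[of x] orth_proj_in[of x] that by simp

text \<open>The error of the projection is orthogonal to \<open>x\<close> and to the projection,
  hence zero. Membership can then be checked coordinatewise against the complement, with no
  approximation by finite sums.\<close>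

lemma mem_if_orth_compl_orth:
  assumes "\<And>z. z \<in> orth_compl M \<Longrightarrow> cinner z x = 0" shows "x \<in> M"
proof -
  define z where "z = x - orth_proj M x"
  have z: "z \<in> orth_compl M" unfolding z_def by (rule orth_proj_diff)
  have "cinner z z = cinner z x - cinner z (orth_proj M x)"
    by (simp add: z_def cinner.diff_right)
  also have "\<dots> = 0"
    using assms[OF z] orth_complD[OF z orth_proj_in] by simp
  finally show ?thesis using orth_proj_in[of x] by (simp add: z_def)
qed

lemma cinner_orth_proj: "m \<in> M \<Longrightarrow> cinner (orth_proj M x) m = cinner x m"
  using orth_complD[OF orth_proj_diff, of m x] by (simp add: cinner.diff_left)

end

section \<open>Riesz representation and adjoints\<close>

lemma riesz_representation:
  fixes f :: "'a::complex_hilbert \<Rightarrow> complex"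
  assumes add: "\<And>x y. f (x + y) = f x + f y" and scale: "\<And>c x. f (c *\<^sub>C x) = c * f x"
    and bound: "\<And>x. cmod (f x) \<le> B * norm x"
  shows "\<exists>b. \<forall>x. f x = cinner x b"
proof (cases "\<forall>x. f x = 0")
  case False
  have lin: "bounded_linear f"
  proof (rule bounded_linear_intro[of _ B])
    fix r x show "f (r *\<^sub>R x) = r *\<^sub>R f x"
      using scale[of "of_real r" x] by (simp add: scaleC_of_real scaleR_conv_of_real)
  qed (use add bound in \<open>auto simp: mult.commute\<close>)
  define N where "N = {x. f x = 0}"
  have N: "closed_csubspace N"
    unfolding closed_csubspace_def complex_vector.subspace_def N_def
    using scale[of 0 0]
    by (auto simp: add scale intro!: closed_Collect_eq linear_continuous_on[OF lin] continuous_on_const)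
  obtain x\<^sub>0 where x0: "f x\<^sub>0 \<noteq> 0" using False by blast
  \<comment> \<open>The part of \<open>x\<^sub>0\<close> orthogonal to the kernel; it spans the
    direction of the representing vector.\<close>
  define w where "w = x\<^sub>0 - orth_proj N x\<^sub>0"
  have w: "w \<in> orth_compl N" unfolding w_def by (rule orth_proj_diff[OF N])
  have "f w = f x\<^sub>0"
    using orth_proj_in[OF N, of x\<^sub>0] linear_diff[OF bounded_linear.linear[OF lin]]
    by (simp add: w_def N_def)
  with x0 have fw: "f w \<noteq> 0" by simp
  then have w0: "w \<noteq> 0" using linear_0[OF bounded_linear.linear[OF lin]] by auto
  have "f x = cinner x (cnj (f w / cinner w w) *\<^sub>C w)" for x
  proof -
    \<comment> \<open>This combination lies in the kernel \<open>N\<close>, so it is orthogonal to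
      \<open>w\<close>; solving that equation for \<open>f x\<close> gives the
      representation.\<close>
    have "f (f x *\<^sub>C w - f w *\<^sub>C x) = 0"
      using linear_diff[OF bounded_linear.linear[OF lin]] by (simp add: scale)
    then have "cinner w (f x *\<^sub>C w - f w *\<^sub>C x) = 0"
      using w by (auto simp: orth_compl_def N_def)
    then have "cinner (f x *\<^sub>C w - f w *\<^sub>C x) w = 0"
      by (simp add: cinner_eq_0_commute)
    then show ?thesis
      using w0 by (simp add: cinner.diff_left cinner_scaleC_left cinner_scaleC_right field_simps)
  qed
  then show ?thesis by blast
qed (auto intro: exI[of _ 0])

text \<open>The definite description in \<open>cadjoint\<close> has a solution by Riesz, applied for
  each \<open>y\<close>, and only one because the inner product is nondegenerate.\<close>

lemma cinner_cadjoint: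
  fixes A :: "'a::complex_hilbert \<Rightarrow> 'b::complex_inner"
  assumes A: "bounded_clinear A"
  shows "cinner (A x) y = cinner x (cadjoint A y)"
proof -
  obtain K where K: "\<And>x. norm (A x) \<le> norm x * K"
    using bounded_linear.bounded[OF bounded_clinear_imp_bounded_linear[OF A]] by blast
  have "\<exists>b. \<forall>x. cinner (A x) y = cinner x b" for y
  proof (rule riesz_representation)
    fix x show "cmod (cinner (A x) y) \<le> (K * norm y) * norm x"
      using norm_cinner_le[of "A x" y] mult_right_mono[OF K[of x], of "norm y"]
      by (simp add: mult_ac)
  qed (use bounded_clinear_onD[OF A] in \<open>auto simp: cinner_add_left cinner_scaleC_left\<close>)
  then obtain B where B: "\<forall>x y. cinner (A x) y = cinner x (B y)" by metis
  have "\<exists>!B. \<forall>x y. cinner (A x) y = cinner x (B y)"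
  proof (rule ex1I[of _ B])
    fix C assume C: "\<forall>x y. cinner (A x) y = cinner x (C y)"
    show "C = B"
    proof
      fix y
      have "cinner (C y - B y) (C y - B y) = 0"
        unfolding cinner.diff_right[of _ "C y" "B y"] using B C by (metis diff_self)
      then show "C y = B y" by simp
    qed
  qed (rule B)
  from theI'[OF this] show ?thesis unfolding cadjoint_def by blast
qed


section \<open>Isometric pencils\<close>

locale isometric_pencil =
  fixes V\<^sub>0 V\<^sub>1 :: "'x::complex_hilbert \<Rightarrow> 'x"
  assumes V0: "bounded_clinear V\<^sub>0" and V1: "bounded_clinear V\<^sub>1"
    and isometric: "\<And>\<mu> x. \<mu> \<in> unit_circle \<Longrightarrow> norm (pencil V\<^sub>0 V\<^sub>1 \<mu> x) = norm x"
begin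

text \<open>The norm of \<open>pencil V\<^sub>0 V\<^sub>1 \<mu> x\<close> does not depend on
  \<open>\<mu>\<close>, so its cross term vanishes; polarization then frees the two
  arguments.\<close>

lemma cinner_V0_V1: "cinner (V\<^sub>0 x) (V\<^sub>1 y) = 0"
proof -
  have sq: "(norm x)\<^sup>2 = (norm (V\<^sub>0 x))\<^sup>2 + (norm (V\<^sub>1 x))\<^sup>2 + 2 * Re (cnj \<mu> * cinner (V\<^sub>0 x) (V\<^sub>1 x))"
    if "\<mu> \<in> unit_circle" for \<mu> x
  proof -
    have "(norm x)\<^sup>2 = (norm (V\<^sub>0 x + \<mu> *\<^sub>C V\<^sub>1 x))\<^sup>2"
      using isometric[OF that, of x] by (simp add: pencil_def)
    also have "\<dots> = (norm (V\<^sub>0 x))\<^sup>2 + (norm (\<mu> *\<^sub>C V\<^sub>1 x))\<^sup>2 + 2 * inner (V\<^sub>0 x) (\<mu> *\<^sub>C V\<^sub>1 x)"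
      by (simp add: power2_norm_eq_inner inner_add_left inner_add_right inner_commute)
    also have "norm (\<mu> *\<^sub>C V\<^sub>1 x) = norm (V\<^sub>1 x)"
      using that by (simp add: norm_scaleC)
    also have "inner (V\<^sub>0 x) (\<mu> *\<^sub>C V\<^sub>1 x) = Re (cnj \<mu> * cinner (V\<^sub>0 x) (V\<^sub>1 x))"
      by (simp add: Re_cinner[symmetric] cinner_scaleC_right)
    finally show ?thesis .
  qed
  \<comment> \<open>The values 1 and -1 remove the real part, the values \<open>\<i>\<close> and
    \<open>- \<i>\<close> the imaginary part.\<close>
  have diag: "cinner (V\<^sub>0 x) (V\<^sub>1 x) = 0" for x
    using sq[of 1 x] sq[of "-1" x] sq[of \<i> x] sq[of "-\<i>" x] by (simp add: complex_eq_iff)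
  note lin = bounded_clinear_onD[OF V0] bounded_clinear_onD[OF V1]
  \<comment> \<open>Polarization: \<open>x + y\<close> shows that the two mixed terms are opposite,
    \<open>x + \<i> *\<^sub>C y\<close> that they are equal.\<close>
  have "cinner (V\<^sub>0 x) (V\<^sub>1 y) + cinner (V\<^sub>0 y) (V\<^sub>1 x) = 0"
    using diag[of "x + y"] by (simp add: lin cinner_add_left cinner_add_right diag add.commute)
  moreover have "cnj \<i> * cinner (V\<^sub>0 x) (V\<^sub>1 y) + \<i> * cinner (V\<^sub>0 y) (V\<^sub>1 x) = 0"
    using diag[of "x + \<i> *\<^sub>C y"]
    by (simp add: lin cinner_add_left cinner_add_right diag cinner_scaleC_left cinner_scaleC_right)
  ultimately show ?thesis
    by (auto simp: complex_eq_iff)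
qed

lemma pencil_clinear: "bounded_clinear (pencil V\<^sub>0 V\<^sub>1 \<mu>)"
  by (rule bounded_clinear_pencil[OF V0 V1])

text \<open>An isometry carries the complete space onto a complete, hence closed, range. The single
  coefficients are not isometric in general, so their ranges need a closure in
  \<open>R\<^sub>0\<close> and \<open>R\<^sub>1\<close>.\<close>

lemma closed_csubspace_range_pencil:
  assumes "\<mu> \<in> unit_circle" shows "closed_csubspace (range (pencil V\<^sub>0 V\<^sub>1 \<mu>))"
proof -
  have "complete (range (pencil V\<^sub>0 V\<^sub>1 \<mu>))"
    by (rule complete_isometric_image[of 1])
      (use bounded_clinear_imp_bounded_linear[OF pencil_clinear] isometric[OF assms] in
        \<open>auto intro: complete_UNIV\<close>)
  then show ?thesis
    by (simp add: closed_csubspace_def csubspace_range[OF pencil_clinear] complete_imp_closed)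
qed

text \<open>For the pencil of the model, \<open>VV\<close>, \<open>P\<close>, \<open>UU\<close> and
  \<open>Q\<close> become \<open>space_V\<close>, \<open>model_P\<close>, \<open>space_U\<close> and
  \<open>model_Q\<close>; their geometry depends only on the pencil being isometric.\<close>

definition "R\<^sub>0 = closure (range V\<^sub>0)"
definition "R\<^sub>1 = closure (range V\<^sub>1)"
definition "VV = closure (cspan (\<Union>\<mu>\<in>unit_circle. range (pencil V\<^sub>0 V\<^sub>1 \<mu>)))"
definition "P \<mu> x = orth_proj R\<^sub>0 x + \<mu> *\<^sub>C orth_proj R\<^sub>1 x"
definition "UU = (VV \<inter> orth_compl (range (pencil V\<^sub>0 V\<^sub>1 1))) \<times> orth_compl VV"
definition "Q \<mu> = (\<lambda>(k, l). P \<mu> k + l)"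

section \<open>The decomposition of \<open>VV\<close> and the unitarity of \<open>P\<close>\<close>

lemma R0: "closed_csubspace R\<^sub>0" and R1: "closed_csubspace R\<^sub>1" and VV: "closed_csubspace VV"
  unfolding R\<^sub>0_def R\<^sub>1_def VV_def
  by (intro closed_csubspace_closure csubspace_range V0 V1 complex_vector.subspace_span)+

lemma cinner_R0_R1: "x \<in> R\<^sub>0 \<Longrightarrow> y \<in> R\<^sub>1 \<Longrightarrow> cinner x y = 0"
proof -
  assume x: "x \<in> R\<^sub>0" and y: "y \<in> R\<^sub>1"
  have "cinner (V\<^sub>1 b) x = 0" for b
    by (rule in_orth_compl_closure[of _ "range V\<^sub>0"])
      (use x in \<open>auto simp: R\<^sub>0_def orth_compl_def cinner_eq_0_commute[of "V\<^sub>1 b"] cinner_V0_V1\<close>)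
  then have "x \<in> orth_compl (range V\<^sub>1)"
    by (auto simp: orth_compl_def cinner_eq_0_commute[of x])
  then show "cinner x y = 0"
    using y unfolding R\<^sub>1_def by (rule in_orth_compl_closure)
qed

lemma orth_proj_R0_R1: "y \<in> R\<^sub>1 \<Longrightarrow> orth_proj R\<^sub>0 y = 0" "x \<in> R\<^sub>0 \<Longrightarrow> orth_proj R\<^sub>1 x = 0"
  using cinner_R0_R1
  by (auto intro!: orth_proj_orth R0 R1 orth_complI simp: cinner_eq_0_commute[of y])

lemma V_in_VV: "\<mu> \<in> unit_circle \<Longrightarrow> pencil V\<^sub>0 V\<^sub>1 \<mu> x \<in> VV"
  unfolding VV_def by (rule subsetD[OF closure_subset]) (auto intro!: complex_vector.span_base)

text \<open>The coefficients are the half sum and the half difference of the values at 1 and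
  -1.\<close>

lemma V0_V1_in_VV: "V\<^sub>0 x \<in> VV" "V\<^sub>1 x \<in> VV"
proof -
  note s = V_in_VV[of 1 x] V_in_VV[of "-1" x]
  have "complex_of_real (1/2) *\<^sub>C (pencil V\<^sub>0 V\<^sub>1 1 x + pencil V\<^sub>0 V\<^sub>1 (-1) x) \<in> VV"
    "complex_of_real (1/2) *\<^sub>C (pencil V\<^sub>0 V\<^sub>1 1 x - pencil V\<^sub>0 V\<^sub>1 (-1) x) \<in> VV"
    using s closed_csubspaceD[OF VV] by auto
  then show "V\<^sub>0 x \<in> VV" "V\<^sub>1 x \<in> VV"
    unfolding scaleC_of_real pencil_def
    by (simp_all add: scaleC.minus_left scaleR_2[symmetric])
qed

lemma R0_R1_subset: "R\<^sub>0 \<subseteq> VV" "R\<^sub>1 \<subseteq> VV"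
  unfolding R\<^sub>0_def R\<^sub>1_def
  by (rule closure_minimal; use V0_V1_in_VV closed_csubspaceD(2)[OF VV] in blast)+

lemma proj_R_V [simp]:
  "orth_proj R\<^sub>0 (V\<^sub>0 x) = V\<^sub>0 x" "orth_proj R\<^sub>1 (V\<^sub>1 x) = V\<^sub>1 x"
  "orth_proj R\<^sub>0 (V\<^sub>1 x) = 0" "orth_proj R\<^sub>1 (V\<^sub>0 x) = 0"
proof -
  have in0: "V\<^sub>0 x \<in> R\<^sub>0" and in1: "V\<^sub>1 x \<in> R\<^sub>1"
    unfolding R\<^sub>0_def R\<^sub>1_def by (rule subsetD[OF closure_subset rangeI])+
  show "orth_proj R\<^sub>0 (V\<^sub>0 x) = V\<^sub>0 x" "orth_proj R\<^sub>1 (V\<^sub>1 x) = V\<^sub>1 x"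
    using orth_proj_same[OF R0 in0] orth_proj_same[OF R1 in1] by -
  show "orth_proj R\<^sub>0 (V\<^sub>1 x) = 0" "orth_proj R\<^sub>1 (V\<^sub>0 x) = 0"
    by (rule orth_proj_R0_R1 in0 in1)+
qed

text \<open>The vectors fixed by the sum of the two projections form a closed subspace that contains
  all values of the pencil, hence all of \<open>VV\<close>.\<close>

lemma VV_decomposition:
  assumes "x \<in> VV" shows "orth_proj R\<^sub>0 x + orth_proj R\<^sub>1 x = x"
proof -
  let ?S = "{x. orth_proj R\<^sub>0 x + orth_proj R\<^sub>1 x = x}"
  have "closed ?S"
    by (intro closed_Collect_eq continuous_on_add continuous_on_id
        linear_continuous_on[OF bounded_clinear_imp_bounded_linear[OF bounded_clinear_orth_proj]]
        R0 R1)
  moreover have "csubspace ?S"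
    unfolding complex_vector.subspace_def
    using closed_csubspaceD(3)[OF R0] closed_csubspaceD(3)[OF R1]
    by (auto simp: orth_proj_add[OF R0] orth_proj_add[OF R1] orth_proj_scaleC[OF R0]
        orth_proj_scaleC[OF R1] orth_proj_same[OF R0] orth_proj_same[OF R1]
        scaleC_add_right[symmetric] algebra_simps)
  moreover have "pencil V\<^sub>0 V\<^sub>1 \<mu> x \<in> ?S" for \<mu> x
    by (simp add: pencil_def orth_proj_add[OF R0] orth_proj_add[OF R1] orth_proj_scaleC[OF R0]
        orth_proj_scaleC[OF R1])
  ultimately have "VV \<subseteq> ?S"
    unfolding VV_def by (intro closure_minimal complex_vector.span_minimal) auto
  with assms show ?thesis by auto
qed

lemma P_clinear: "bounded_clinear (P \<mu>)"
  using bounded_clinear_pencil[OF bounded_clinear_orth_proj[OF R0] bounded_clinear_orth_proj[OF R1]]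
  by (simp add: bounded_clinear_on_def P_def pencil_def)

lemma P_in_VV: "P \<mu> x \<in> VV"
  unfolding P_def using R0_R1_subset orth_proj_in[OF R0] orth_proj_in[OF R1] closed_csubspaceD[OF VV]
  by blast

text \<open>The components in \<open>R\<^sub>0\<close> and \<open>R\<^sub>1\<close> do not interact,
  and in the latter \<open>\<mu> * cnj \<mu> = 1\<close> cancels.\<close>

lemma cinner_P_P:
  assumes "\<mu> \<in> unit_circle" "x \<in> VV" "y \<in> VV"
  shows "cinner (P \<mu> x) (P \<mu> y) = cinner x y"
proof -
  have [simp]: "\<mu> * cnj \<mu> = 1" "cnj \<mu> * \<mu> = 1"
    using assms(1) by (simp_all add: complex_norm_square[symmetric] mult.commute)
  have [simp]: "cinner (orth_proj R\<^sub>0 a) (orth_proj R\<^sub>1 b) = 0"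
    "cinner (orth_proj R\<^sub>1 b) (orth_proj R\<^sub>0 a) = 0" for a b
    using cinner_R0_R1[OF orth_proj_in[OF R0] orth_proj_in[OF R1]]
    by (simp_all add: cinner_eq_0_commute[of "orth_proj R\<^sub>1 b" "orth_proj R\<^sub>0 a"])
  have "cinner (P \<mu> x) (P \<mu> y)
      = cinner (orth_proj R\<^sub>0 x + orth_proj R\<^sub>1 x) (orth_proj R\<^sub>0 y + orth_proj R\<^sub>1 y)"
    unfolding P_def
    by (simp add: cinner_add_left cinner_add_right cinner_scaleC_left cinner_scaleC_right
        mult.assoc[symmetric])
  then show ?thesis
    using assms VV_decomposition by simp
qed

text \<open>The projections separate the two summands of the value at 1. This relation transports
  orthogonality to the range at 1 to the range at \<open>\<mu>\<close>.\<close>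

lemma P_V: "P \<mu> (pencil V\<^sub>0 V\<^sub>1 1 x) = pencil V\<^sub>0 V\<^sub>1 \<mu> x"
  by (simp add: P_def pencil_def orth_proj_add[OF R0] orth_proj_add[OF R1])

text \<open>On the circle \<open>cnj \<mu>\<close> inverts \<open>\<mu>\<close>, which gives
  surjectivity of \<open>P \<mu>\<close> on \<open>VV\<close>.\<close>

lemma P_P_cnj:
  assumes "\<mu> \<in> unit_circle" "x \<in> VV" shows "P \<mu> (P (cnj \<mu>) x) = x"
proof -
  have [simp]: "\<mu> * cnj \<mu> = 1"
    using assms(1) by (simp add: complex_norm_square[symmetric])
  have "orth_proj R\<^sub>0 (orth_proj R\<^sub>1 y) = 0" "orth_proj R\<^sub>1 (orth_proj R\<^sub>0 y) = 0" for y
    by (rule orth_proj_R0_R1 orth_proj_in R0 R1)+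
  moreover have "orth_proj R\<^sub>0 (orth_proj R\<^sub>0 y) = orth_proj R\<^sub>0 y"
    "orth_proj R\<^sub>1 (orth_proj R\<^sub>1 y) = orth_proj R\<^sub>1 y" for y
    by (simp_all add: orth_proj_same R0 R1 orth_proj_in)
  ultimately show ?thesis
    using VV_decomposition[OF assms(2)]
    by (simp add: P_def orth_proj_add orth_proj_scaleC R0 R1 scaleC_scaleC)
qed

section \<open>\<open>Q\<close> as an isometry onto the complement of the range of the
  pencil\<close>

lemma Q_orth_range:
  assumes "\<mu> \<in> unit_circle" "w \<in> UU" shows "Q \<mu> w \<in> orth_compl (range (pencil V\<^sub>0 V\<^sub>1 \<mu>))"
proof -
  obtain k l where w: "w = (k, l)" "k \<in> VV" "k \<in> orth_compl (range (pencil V\<^sub>0 V\<^sub>1 1))"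
    "l \<in> orth_compl VV"
    using assms(2) by (auto simp: UU_def)
  have "cinner (Q \<mu> w) (pencil V\<^sub>0 V\<^sub>1 \<mu> x) = 0" for x
  proof -
    have "cinner (P \<mu> k) (pencil V\<^sub>0 V\<^sub>1 \<mu> x) = cinner k (pencil V\<^sub>0 V\<^sub>1 1 x)"
      unfolding P_V[of \<mu> x, symmetric] using assms w by (intro cinner_P_P V_in_VV) auto
    then show ?thesis
      using w V_in_VV[OF assms(1)] by (auto simp: Q_def cinner_add_left orth_compl_def)
  qed
  then show ?thesis by (auto simp: orth_compl_def)
qed

lemma norm_Q:
  assumes "\<mu> \<in> unit_circle" "w \<in> UU" shows "norm (Q \<mu> w) = norm w"
proof -
  obtain k l where w: "w = (k, l)" "k \<in> VV" "l \<in> orth_compl VV"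
    using assms(2) by (auto simp: UU_def)
  have "complex_of_real ((norm (P \<mu> k))\<^sup>2) = complex_of_real ((norm k)\<^sup>2)"
    using cinner_P_P[OF assms(1) w(2,2)] by (simp add: cinner_self)
  then have "(norm (P \<mu> k))\<^sup>2 = (norm k)\<^sup>2"
    by (simp only: of_real_eq_iff)
  moreover have "cinner (P \<mu> k) l = 0"
    using orth_complD[OF w(3) P_in_VV] cinner_eq_0_commute by blast
  ultimately have "(norm (Q \<mu> w))\<^sup>2 = (norm w)\<^sup>2"
    using norm_add_sq_orth[of "P \<mu> k" l] by (simp add: w(1) Q_def norm_Pair)
  then show ?thesis by (rule power2_eq_imp_eq) simp_all
qed

lemma Q_surj:
  assumes "\<mu> \<in> unit_circle" "x \<in> orth_compl (range (pencil V\<^sub>0 V\<^sub>1 \<mu>))"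
  shows "\<exists>w\<in>UU. Q \<mu> w = x"
proof -
  \<comment> \<open>Splitting \<open>x\<close> along \<open>VV\<close> leaves \<open>x - v\<close>
    as the second component; the part \<open>v\<close> is pulled back by the inverse of
    \<open>P \<mu>\<close>.\<close>
  define v where "v = orth_proj VV x"
  define k where "k = P (cnj \<mu>) v"
  have vV: "v \<in> VV" unfolding v_def by (rule orth_proj_in[OF VV])
  have Pk: "P \<mu> k = v" unfolding k_def by (rule P_P_cnj[OF assms(1) vV])
  have kV: "k \<in> VV" unfolding k_def by (rule P_in_VV)
  have "cinner k (pencil V\<^sub>0 V\<^sub>1 1 a) = 0" for a
  proof -
    have "cinner k (pencil V\<^sub>0 V\<^sub>1 1 a) = cinner (P \<mu> k) (P \<mu> (pencil V\<^sub>0 V\<^sub>1 1 a))"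
      using assms(1) kV by (intro cinner_P_P[symmetric] V_in_VV) auto
    also have "\<dots> = cinner x (pencil V\<^sub>0 V\<^sub>1 \<mu> a)"
      unfolding Pk P_V v_def by (rule cinner_orth_proj[OF VV V_in_VV[OF assms(1)]])
    finally show ?thesis using assms(2) by (simp add: orth_compl_def)
  qed
  then have "(k, x - v) \<in> UU"
    using kV orth_proj_diff[OF VV, of x] by (auto simp: UU_def orth_compl_def v_def)
  then show ?thesis
    using Pk by (intro bexI[of _ "(k, x - v)"]) (auto simp: Q_def)
qed

lemma closed_csubspace_UU: "closed_csubspace UU"
  unfolding UU_def
  by (intro closed_csubspace_Times closed_csubspace_Int VV closed_csubspace_orth_compl)

text \<open>Splits \<open>x\<close> along the closed range of the pencil. With
  \<open>norm_VQ\<close> this says that \<open>(a, w)\<close> is carried unitarily onto the whole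
  space, which is the nontrivial part of the unitarity of \<open>U\<close>.\<close>

lemma VQ_surj:
  assumes "\<mu> \<in> unit_circle" shows "\<exists>a. \<exists>w\<in>UU. pencil V\<^sub>0 V\<^sub>1 \<mu> a + Q \<mu> w = x"
proof -
  note R = closed_csubspace_range_pencil[OF assms]
  obtain a where a: "orth_proj (range (pencil V\<^sub>0 V\<^sub>1 \<mu>)) x = pencil V\<^sub>0 V\<^sub>1 \<mu> a"
    using orth_proj_in[OF R, of x] by blast
  obtain w where "w \<in> UU" "Q \<mu> w = x - pencil V\<^sub>0 V\<^sub>1 \<mu> a"
    using Q_surj[OF assms orth_proj_diff[OF R, of x]] a by auto
  then show ?thesis by (intro exI[of _ a] bexI[of _ w]) auto
qed

lemma norm_VQ:
  assumes "\<mu> \<in> unit_circle" "w \<in> UU"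
  shows "(norm (pencil V\<^sub>0 V\<^sub>1 \<mu> a + Q \<mu> w))\<^sup>2 = (norm a)\<^sup>2 + (norm w)\<^sup>2"
proof -
  have "cinner (pencil V\<^sub>0 V\<^sub>1 \<mu> a) (Q \<mu> w) = 0"
    using orth_complD[OF Q_orth_range[OF assms], of "pencil V\<^sub>0 V\<^sub>1 \<mu> a"] cinner_eq_0_commute by blast
  from norm_add_sq_orth[OF this] show ?thesis
    by (simp add: isometric[OF assms(1)] norm_Q[OF assms])
qed

end


section \<open>Linear outer functions\<close>

lemma vec_holomorphic_on_imp_continuous_on:
  "vec_holomorphic_on f S \<Longrightarrow> continuous_on S f"
  unfolding vec_holomorphic_on_def
  using has_derivative_continuous by (auto simp: continuous_on_eq_continuous_within) blast

lemma const_in_hardy2: "(\<lambda>_. y) \<in> hardy2"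
proof -
  have "vec_holomorphic_on (\<lambda>_. y) (ball 0 1)"
    unfolding vec_holomorphic_on_def by (auto intro!: exI[of _ 0])
  moreover have "bdd_above (circle_mean (\<lambda>_. y) ` {0<..<1})"
    by (rule bdd_aboveI[of _ "(norm y)\<^sup>2"]) (auto simp: circle_mean_def)
  ultimately show ?thesis by (simp add: hardy2_def)
qed

text \<open>A vector \<open>y\<close> orthogonal to both ranges is orthogonal to every value of \<open>F f\<close>, so the
  constant function \<open>y\<close> has distance at least \<open>norm y\<close> from \<open>F H\<^sup>2\<close>.\<close>

lemma outer_pencil_ranges_total:
  fixes F\<^sub>0 F\<^sub>1 :: "'h::complex_hilbert \<Rightarrow> 'y::complex_hilbert"
  assumes F: "bounded_clinear F\<^sub>0" "bounded_clinear F\<^sub>1" and out: "outer (pencil F\<^sub>0 F\<^sub>1)"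
    and y: "y \<in> orth_compl (range F\<^sub>0 \<union> range F\<^sub>1)"
  shows "y = 0"
proof (rule ccontr)
  assume "y \<noteq> 0"
  then have "0 < norm y" by simp
  moreover have "\<forall>g\<in>hardy2. \<forall>\<epsilon>>0. \<exists>f\<in>hardy2. hardy_norm (\<lambda>z. pencil F\<^sub>0 F\<^sub>1 z (f z) - g z) < \<epsilon>"
    using out unfolding outer_def by simp
  ultimately obtain f where f: "f \<in> hardy2"
    and lt: "hardy_norm (\<lambda>z. pencil F\<^sub>0 F\<^sub>1 z (f z) - y) < norm y"
    using const_in_hardy2[of y] by meson
  define g where "g z = pencil F\<^sub>0 F\<^sub>1 z (f z)" for z
  have contf: "continuous_on (ball 0 1) f"
    using f by (auto simp: hardy2_def intro: vec_holomorphic_on_imp_continuous_on)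
  have contg: "continuous_on (ball 0 1) g"
    unfolding g_def pencil_def
    by (intro continuous_on_add scaleC.continuous_on continuous_on_id
        bounded_linear.continuous_on[OF bounded_clinear_imp_bounded_linear[OF F(1)] contf]
        bounded_linear.continuous_on[OF bounded_clinear_imp_bounded_linear[OF F(2)] contf])
  \<comment> \<open>The linearity and the monotonicity of the integral used below require
    integrability, which comes from continuity on the open disk.\<close>
  have int: "(\<lambda>s. (norm (u (complex_of_real r * cis s)))\<^sup>2) integrable_on {0..2 * pi}"
    if "continuous_on (ball 0 1) u" "r \<in> {0<..<1}" for u :: "complex \<Rightarrow> 'b::complex_inner" and r
  proof (rule integrable_continuous_real)
    have "continuous_on {0..2 * pi} (u \<circ> (\<lambda>s. complex_of_real r * cis s))"
      using that(2)
      by (intro continuous_on_compose continuous_on_subset[OF that(1)] continuous_intros)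
        (auto simp: norm_mult)
    then show "continuous_on {0..2 * pi} (\<lambda>s. (norm (u (complex_of_real r * cis s)))\<^sup>2)"
      by (intro continuous_intros) (simp add: o_def)
  qed
  have "cinner (F\<^sub>0 h) y = 0" "cinner (F\<^sub>1 h) y = 0" for h
    using orth_complD[OF y, of "F\<^sub>0 h"] orth_complD[OF y, of "F\<^sub>1 h"]
      cinner_eq_0_commute[of y "F\<^sub>0 h"] cinner_eq_0_commute[of y "F\<^sub>1 h"] by simp_all
  then have "cinner (g z) y = 0" for z
    by (simp add: g_def pencil_def cinner_add_left cinner_scaleC_left)
  then have sq: "(norm (g z - y))\<^sup>2 = (norm (g z))\<^sup>2 + (norm y)\<^sup>2" for z
    using norm_add_sq_orth[of "g z" "- y"] by (simp add: cinner.minus_right)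
  have mean: "circle_mean (\<lambda>z. g z - y) r = circle_mean g r + (norm y)\<^sup>2" if "r \<in> {0<..<1}" for r
    unfolding circle_mean_def sq
    by (subst integral_add[OF int[OF contg that] integrable_const_ivl]) (simp add: add_divide_distrib)
  \<comment> \<open>Contractivity of the outer function bounds the means uniformly. Without such a
    bound the supremum in \<open>hardy_norm\<close> would have no usable value.\<close>
  have "circle_mean g r \<le> circle_mean f r" if r: "r \<in> {0<..<1}" for r
    unfolding circle_mean_def
  proof (intro divide_right_mono integral_le int contf contg r power_mono)
    fix s
    have "complex_of_real r * cis s \<in> ball 0 1" using r by (simp add: norm_mult)
    then show "norm (g (complex_of_real r * cis s)) \<le> norm (f (complex_of_real r * cis s))"
      using out unfolding outer_def g_def by blast
  qed auto
  moreover obtain B where "\<forall>r\<in>{0<..<1}. circle_mean f r \<le> B"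
    using f unfolding hardy2_def bdd_above_def by blast
  ultimately have bdd: "bdd_above (circle_mean (\<lambda>z. g z - y) ` {0<..<1})"
    by (intro bdd_aboveI[of _ "B + (norm y)\<^sup>2"]) (force simp: mean)
  \<comment> \<open>One radius is enough to bound the supremum from below; 1/2 is arbitrary.\<close>
  have "circle_mean g (1/2) \<ge> 0"
    unfolding circle_mean_def using int[OF contg, of "1/2"]
    by (intro divide_nonneg_pos integral_nonneg) auto
  then have "(norm y)\<^sup>2 \<le> circle_mean (\<lambda>z. g z - y) (1/2)"
    by (simp add: mean)
  also have "\<dots> \<le> (SUP r\<in>{0<..<1}. circle_mean (\<lambda>z. g z - y) r)"
    using bdd by (intro cSUP_upper) auto
  finally have "norm y \<le> hardy_norm (\<lambda>z. g z - y)"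
    unfolding hardy_norm_def by (rule real_le_rsqrt)
  with lt show False by (simp add: g_def)
qed


section \<open>Square-summable sequences\<close>

lemma ell2_nth_simps [simp]:
  "ell2_nth (ell2_cons a x) 0 = a" "ell2_nth (ell2_cons a x) (Suc n) = ell2_nth x n"
  "ell2_nth (ell2_tail x) n = ell2_nth x (Suc n)"
  "ell2_nth 0 n = 0" "ell2_nth (x + y) n = ell2_nth x n + ell2_nth y n"
  "ell2_nth (c *\<^sub>C x) n = c *\<^sub>C ell2_nth x n"
  by (simp_all add: ell2_cons.rep_eq ell2_tail.rep_eq zero_ell2.rep_eq plus_ell2.rep_eq
      scaleC_ell2.rep_eq)

lemma ell2_cons_eqI: "ell2_nth x 0 = a \<Longrightarrow> ell2_tail x = y \<Longrightarrow> ell2_cons a y = x"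
proof (rule ell2_eqI)
  fix n assume "ell2_nth x 0 = a" "ell2_tail x = y"
  then show "ell2_nth (ell2_cons a y) n = ell2_nth x n" by (cases n) auto
qed

lemma ell2_tail_cons [simp]: "ell2_tail (ell2_cons a x) = x"
  by (rule ell2_eqI) simp

lemma ell2_tail_zero [simp]: "ell2_tail 0 = 0"
  by (rule ell2_eqI) simp

lemma ell2_tail_add: "ell2_tail (x + y) = ell2_tail x + ell2_tail y"
  and ell2_tail_scaleC: "ell2_tail (c *\<^sub>C x) = c *\<^sub>C ell2_tail x"
  by (rule ell2_eqI, simp)+

lemma ell2_cons_add: "ell2_cons (a + b) (x + y) = ell2_cons a x + ell2_cons b y"
  and ell2_cons_scaleC: "ell2_cons (c *\<^sub>C a) (c *\<^sub>C x) = c *\<^sub>C ell2_cons a x"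
  by (rule ell2_cons_eqI; simp add: ell2_tail_add ell2_tail_scaleC)+

lemma norm_ell2_split: "(norm x)\<^sup>2 = (norm (ell2_nth x 0))\<^sup>2 + (norm (ell2_tail x))\<^sup>2"
  unfolding norm_ell2_sq using suminf_split_head[OF summable_ell2, of x] by simp

lemma cinner_ell2_split:
  "cinner x y = cinner (ell2_nth x 0) (ell2_nth y 0) + cinner (ell2_tail x) (ell2_tail y)"
  unfolding cinner_ell2_def using suminf_split_head[OF summable_cinner_ell2, of x y] by simp

lemma bounded_clinear_ell2_nth: "bounded_clinear (\<lambda>x. ell2_nth x n)"
  unfolding bounded_clinear_on_def by (auto intro!: exI[of _ 1] norm_ell2_nth_le)

lemma bounded_clinear_ell2_tail: "bounded_clinear ell2_tail"
proof -
  have "norm (ell2_tail x) \<le> norm x" for x :: "'a ell2"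
    by (rule power2_le_imp_le) (use norm_ell2_split[of x] in auto)
  then show ?thesis
    unfolding bounded_clinear_on_def
    by (auto intro!: exI[of _ 1] simp: ell2_tail_add ell2_tail_scaleC)
qed

lemma bounded_clinear_ell2_cons: "bounded_clinear (\<lambda>x. ell2_cons (fst x) (snd x))"
proof -
  have "(norm (ell2_cons (fst x) (snd x)))\<^sup>2 = (norm x)\<^sup>2" for x :: "'a \<times> 'a ell2"
    by (simp add: norm_ell2_split[of "ell2_cons (fst x) (snd x)"] norm_prod_def)
  then have "norm (ell2_cons (fst x) (snd x)) \<le> 1 * norm x" for x :: "'a \<times> 'a ell2"
    by (simp add: power2_eq_iff_nonneg)
  then have "\<exists>B. \<forall>x :: 'a \<times> 'a ell2. norm (ell2_cons (fst x) (snd x)) \<le> B * norm x"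
    by blast
  then show ?thesis
    unfolding bounded_clinear_on_def by (simp add: ell2_cons_add ell2_cons_scaleC scaleC_prod_def)
qed

text \<open>Built by repeated shifts, so that the actions of \<open>U\<close> by
  \<open>ell2_cons\<close> and \<open>ell2_tail\<close> match the inductions over the copies in the
  minimality proof.\<close>

primrec ell2_single :: "nat \<Rightarrow> 'a::complex_inner \<Rightarrow> 'a ell2" where
  "ell2_single 0 a = ell2_cons a 0"
| "ell2_single (Suc n) a = ell2_cons 0 (ell2_single n a)"

lemma ell2_nth_single: "ell2_nth (ell2_single n a) k = (if k = n then a else 0)"
proof (induction n arbitrary: k)
  case 0
  show ?case by (cases k) auto
next
  case (Suc n)
  then show ?case by (cases k) auto
qed

lemma cinner_ell2_single: "cinner x (ell2_single n a) = cinner (ell2_nth x n) a"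
proof (induction n arbitrary: x)
  case 0
  show ?case using cinner_ell2_split[of x "ell2_single 0 a"] by simp
next
  case (Suc n)
  then show ?case using cinner_ell2_split[of x "ell2_single (Suc n) a"] by simp
qed


section \<open>The model dilation\<close>

lemma fst_scaleC: "fst (c *\<^sub>C x) = c *\<^sub>C fst x" and snd_scaleC: "snd (c *\<^sub>C x) = c *\<^sub>C snd x"
  by (simp_all add: scaleC_prod_def)

lemma embed_H_linear:
  "embed_H (h + h') = embed_H h + embed_H h'" "embed_H (c *\<^sub>C h) = c *\<^sub>C embed_H h"
  by (simp_all add: embed_H_def scaleC_prod_def)

lemma closed_csubspace_range_embed_H:
  "closed_csubspace (range (embed_H :: 'h \<Rightarrow> ('y::complex_hilbert, 'h::complex_hilbert) Kplus \<times> _))"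
proof -
  have eq: "range embed_H = ({0} \<times> UNIV) \<times> {0 :: (('y, 'h) Kplus \<times> ('y, 'h) Kplus) ell2}"
    by (auto simp: embed_H_def image_def)
  have "closed_csubspace {0}" "closed_csubspace UNIV"
    by (auto simp: closed_csubspace_def complex_vector.subspace_def)
  then show ?thesis
    unfolding eq by (intro closed_csubspace_Times)
      (auto simp: closed_csubspace_def complex_vector.subspace_def)
qed

lemma orth_proj_embed_H: "orth_proj (range embed_H) ((y, h), u) = embed_H h"
proof (rule orth_proj_eqI)
  show "((y, h), u) - embed_H h \<in> orth_compl (range embed_H)"
    by (auto simp: orth_compl_def embed_H_def cinner_prod_def)
qed (use closed_csubspaceD(1)[OF closed_csubspace_range_embed_H] in auto)

lemma pencil_zero:
  assumes "bounded_clinear A" "bounded_clinear B" shows "pencil A B \<mu> 0 = 0"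
  using bounded_clinear_onD(3)[OF assms(1), of 0 0] bounded_clinear_onD(3)[OF assms(2), of 0 0]
  by (simp add: pencil_def)

lemma linear_pencil_clinear_on:
  assumes "linear_pencil M W" "closed_csubspace M" "\<mu> \<in> unit_circle"
  shows "bounded_clinear_on M M (W \<mu>)"
proof -
  obtain A B where A: "bounded_clinear_on M M A" and B: "bounded_clinear_on M M B"
    and W: "\<And>x. x \<in> M \<Longrightarrow> W \<mu> x = A x + \<mu> *\<^sub>C B x"
    using assms(1,3) unfolding linear_pencil_def pencil_def by blast
  note MD = closed_csubspaceD[OF assms(2)]
  note AB = bounded_clinear_onD[OF A] bounded_clinear_onD[OF B]
  obtain a where a: "\<forall>x\<in>M. norm (A x) \<le> a * norm x"
    using A unfolding bounded_clinear_on_def by blast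
  obtain b where b: "\<forall>x\<in>M. norm (B x) \<le> b * norm x"
    using B unfolding bounded_clinear_on_def by blast
  have bd: "norm (W \<mu> x) \<le> (a + b) * norm x" if "x \<in> M" for x
    using norm_triangle_ineq[of "A x" "\<mu> *\<^sub>C B x"] a[rule_format, OF that] b[rule_format, OF that] assms(3)
    by (simp add: W[OF that] norm_scaleC algebra_simps)
  show ?thesis
    by (rule bounded_clinear_onI[OF _ _ _ bd])
      (simp_all add: W MD AB scaleC_add_right scaleC_scaleC mult.commute)
qed

text \<open>The factorization enters as a norm identity and outerness as totality of the two
  ranges.\<close>

locale model_dilation =
  fixes T\<^sub>0 T\<^sub>1 :: "'h::complex_hilbert \<Rightarrow> 'h"
    and F\<^sub>0 F\<^sub>1 :: "'h \<Rightarrow> 'y::complex_hilbert"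
  assumes T: "bounded_clinear T\<^sub>0" "bounded_clinear T\<^sub>1"
    and F: "bounded_clinear F\<^sub>0" "bounded_clinear F\<^sub>1"
    and norm_F_T: "\<And>\<mu> h. \<mu> \<in> unit_circle \<Longrightarrow>
      (norm (pencil F\<^sub>0 F\<^sub>1 \<mu> h))\<^sup>2 + (norm (pencil T\<^sub>0 T\<^sub>1 \<mu> h))\<^sup>2 = (norm h)\<^sup>2"
    and ranges_total: "\<And>y. y \<in> orth_compl (range F\<^sub>0 \<union> range F\<^sub>1) \<Longrightarrow> y = 0"
begin

abbreviation "V\<^sub>0 \<equiv> model_V\<^sub>0 T\<^sub>0 F\<^sub>0"
abbreviation "V\<^sub>1 \<equiv> model_V\<^sub>1 T\<^sub>1 F\<^sub>1"
abbreviation "U \<equiv> model_U T\<^sub>0 T\<^sub>1 F\<^sub>0 F\<^sub>1"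
abbreviation "KK \<equiv> space_K T\<^sub>0 T\<^sub>1 F\<^sub>0 F\<^sub>1"
abbreviation "HH \<equiv> range (embed_H :: 'h \<Rightarrow> ('y, 'h) Kplus \<times> _)"
abbreviation "TT \<equiv> copy_pencil (pencil T\<^sub>0 T\<^sub>1) ::
  complex \<Rightarrow> ('y, 'h) Kplus \<times> (('y, 'h) Kplus \<times> ('y, 'h) Kplus) ell2 \<Rightarrow> _"

section \<open>The isometric pencil of the model\<close>

lemma V0_V1_clinear: "bounded_clinear V\<^sub>0" "bounded_clinear V\<^sub>1"
proof -
  \<comment> \<open>Common shape of both coefficients: \<open>B\<close> is the identity for
    \<open>V\<^sub>0\<close> and zero for \<open>V\<^sub>1\<close>.\<close>
  have *: "bounded_clinear (\<lambda>x. (ell2_cons (A (snd x)) (B (fst x)), C (snd x)))"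
    if "bounded_clinear A" "bounded_clinear B" "bounded_clinear C"
    for A :: "'h \<Rightarrow> 'y" and B :: "'y ell2 \<Rightarrow> 'y ell2" and C :: "'h \<Rightarrow> 'h"
  proof -
    note b = that[THEN bounded_clinear_imp_bounded_linear]
    have "bounded_linear (\<lambda>x. (A (snd x), B (fst x)))"
      by (rule bounded_linear_Pair[OF bounded_linear_compose[OF b(1) bounded_linear_snd]
            bounded_linear_compose[OF b(2) bounded_linear_fst]])
    from bounded_linear_compose[OF bounded_clinear_imp_bounded_linear[OF bounded_clinear_ell2_cons] this]
    have "bounded_linear (\<lambda>x. ell2_cons (A (snd x)) (B (fst x)))" by simp
    from bounded_linear_Pair[OF this bounded_linear_compose[OF b(3) bounded_linear_snd]]
    show ?thesis
      by (simp add: bounded_clinear_iff scaleC_prod_def ell2_cons_scaleC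
          that[THEN bounded_clinear_onD(3), OF UNIV_I])
  qed
  have "bounded_clinear (\<lambda>x::'y ell2. x)" "bounded_clinear (\<lambda>x::'y ell2. 0 :: 'y ell2)"
    by (simp_all add: bounded_clinear_iff)
  from *[OF F(1) this(1) T(1)] *[OF F(2) this(2) T(2)]
  show "bounded_clinear V\<^sub>0" "bounded_clinear V\<^sub>1"
    by (simp_all add: model_V\<^sub>0_def model_V\<^sub>1_def case_prod_unfold)
qed

sublocale isometric_pencil V\<^sub>0 V\<^sub>1
proof
  fix \<mu> and x :: "('y, 'h) Kplus" assume \<mu>: "\<mu> \<in> unit_circle"
  have "(norm (model_V T\<^sub>0 T\<^sub>1 F\<^sub>0 F\<^sub>1 \<mu> x))\<^sup>2 = (norm x)\<^sup>2"
    using norm_F_T[OF \<mu>, of "snd x"] norm_ell2_split[of "ell2_cons a (fst x)" for a]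
    by (simp add: model_V_def case_prod_beta norm_prod_def)
  then show "norm (pencil V\<^sub>0 V\<^sub>1 \<mu> x) = norm x"
    unfolding model_V_pencil by (rule power2_eq_imp_eq) simp_all
qed (fact V0_V1_clinear)+

lemma KK_eq: "KK = {(x, u). \<forall>n. ell2_nth u n \<in> UU}"
  by (simp add: space_K_def space_U_def space_Kc_def space_L_def space_V_def model_V_pencil UU_def VV_def)

lemma model_Q_eq: "model_Q T\<^sub>0 T\<^sub>1 F\<^sub>0 F\<^sub>1 \<mu> = Q \<mu>"
  by (simp add: fun_eq_iff model_Q_def model_P_def Q_def P_def R\<^sub>0_def R\<^sub>1_def)

lemma Q_zero [simp]: "Q \<mu> 0 = 0"
  using bounded_clinear_onD(3)[OF P_clinear, of 0 \<mu> 0] by (simp add: Q_def zero_prod_def)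

text \<open>The definition of \<open>model_U\<close> drops the components of \<open>Q \<mu> w\<close> in all but the first copy of
  the auxiliary space; they vanish because \<open>Q \<mu> w\<close> is orthogonal to the shifted sequences.\<close>

lemma U_eq:
  assumes \<mu>: "\<mu> \<in> unit_circle" and xu: "(x, u) \<in> KK"
  shows "U \<mu> (x, u) = (pencil V\<^sub>0 V\<^sub>1 \<mu> x + Q \<mu> (ell2_nth u 0), ell2_tail u)"
proof -
  define q where "q = Q \<mu> (ell2_nth u 0)"
  have "cinner q (pencil V\<^sub>0 V\<^sub>1 \<mu> (y, 0)) = 0" for y
    using xu Q_orth_range[OF \<mu>] by (auto simp: KK_eq orth_compl_def q_def)
  moreover have "pencil V\<^sub>0 V\<^sub>1 \<mu> (y, 0) = (ell2_cons 0 y, 0)" for y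
    unfolding model_V_pencil[symmetric] by (simp add: model_V_def pencil_zero F T)
  ultimately have "cinner (ell2_tail (fst q)) y = 0" for y
    using cinner_ell2_split[of "fst q" "ell2_cons 0 y"] by (simp add: cinner_prod_def)
  then have "ell2_tail (fst q) = 0"
    using cinner_self_eq_0 by blast
  then have fq: "ell2_cons (comp_Y q) 0 = fst q"
    by (intro ell2_cons_eqI) (simp_all add: comp_Y_def)
  have "ell2_cons (a + comp_Y q) y = ell2_cons a y + fst q" for a y
    using ell2_cons_add[of a "comp_Y q" y 0] fq by simp
  then show ?thesis
    by (simp add: model_U_def model_Q_eq q_def[symmetric] case_prod_beta comp_H_def prod_eq_iff
        model_V_pencil[symmetric] model_V_def)
qed

section \<open>The unitary pencil \<open>U\<close> on \<open>KK\<close>\<close>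

lemma closed_csubspace_KK: "closed_csubspace KK"
proof -
  note UD = closed_csubspaceD[OF closed_csubspace_UU]
  have "KK = UNIV \<times> (\<Inter>n. (\<lambda>u. ell2_nth u n) -` UU)"
    by (auto simp: KK_eq)
  moreover have "closed (\<Inter>n. (\<lambda>u. ell2_nth u n) -` UU)"
    using UD(2)
    by (intro closed_INT ballI closed_vimage linear_continuous_on[OF
          bounded_clinear_imp_bounded_linear[OF bounded_clinear_ell2_nth]])
  moreover have "csubspace KK"
    unfolding complex_vector.subspace_def KK_eq using UD by (auto simp: zero_prod_def scaleC_prod_def)
  ultimately show ?thesis
    by (auto simp: closed_csubspace_def intro: closed_Times)
qed

lemma linear_pencil_U: "linear_pencil KK U"
proof -
  \<comment> \<open>Collects the powers of \<open>\<mu>\<close>: the \<open>space_L\<close> part and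
    the backward shift carry no factor \<open>\<mu>\<close>. The coefficients live on the ambient
    space and preserve \<open>KK\<close>, where \<open>U_eq\<close> identifies their pencil with
    \<open>U\<close>.\<close>
  define D\<^sub>0 where "D\<^sub>0 x = (V\<^sub>0 (fst x) + (orth_proj R\<^sub>0 (fst (ell2_nth (snd x) 0)) + snd (ell2_nth (snd x) 0)),
      ell2_tail (snd x))" for x :: "('y, 'h) Kplus \<times> (('y, 'h) Kplus \<times> ('y, 'h) Kplus) ell2"
  define D\<^sub>1 where "D\<^sub>1 x = (V\<^sub>1 (fst x) + orth_proj R\<^sub>1 (fst (ell2_nth (snd x) 0)),
      0 :: (('y, 'h) Kplus \<times> ('y, 'h) Kplus) ell2)"
    for x :: "('y, 'h) Kplus \<times> (('y, 'h) Kplus \<times> ('y, 'h) Kplus) ell2"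
  note bl = bounded_clinear_imp_bounded_linear
  have "bounded_linear D\<^sub>0" "bounded_linear D\<^sub>1"
    unfolding D\<^sub>0_def[abs_def] D\<^sub>1_def[abs_def]
    by (intro bounded_linear_Pair bounded_linear_add bounded_linear_zero
        bounded_linear_compose[OF bl[OF V0]] bounded_linear_compose[OF bl[OF V1]]
        bounded_linear_compose[OF bl[OF bounded_clinear_orth_proj]] R0 R1
        bounded_linear_compose[OF bl[OF bounded_clinear_ell2_tail]]
        bounded_linear_compose[OF bounded_linear_fst] bounded_linear_compose[OF bounded_linear_snd]
        bounded_linear_compose[OF bl[OF bounded_clinear_ell2_nth]]
        bounded_linear_fst bounded_linear_snd)+
  moreover have "D\<^sub>0 (c *\<^sub>C x) = c *\<^sub>C D\<^sub>0 x" "D\<^sub>1 (c *\<^sub>C x) = c *\<^sub>C D\<^sub>1 x" for c x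
    unfolding D\<^sub>0_def D\<^sub>1_def
    by (rule prod_eqI; simp add: fst_scaleC snd_scaleC bounded_clinear_onD(3)[OF V0]
        bounded_clinear_onD(3)[OF V1] orth_proj_scaleC R0 R1 ell2_tail_scaleC scaleC_add_right)+
  ultimately have "bounded_clinear D\<^sub>0" "bounded_clinear D\<^sub>1"
    by (simp_all add: bounded_clinear_iff)
  moreover have "D\<^sub>0 x \<in> KK" "D\<^sub>1 x \<in> KK" if "x \<in> KK" for x
    using that closed_csubspaceD(3)[OF closed_csubspace_UU] by (auto simp: KK_eq D\<^sub>0_def D\<^sub>1_def)
  ultimately have "bounded_clinear_on KK KK D\<^sub>0" "bounded_clinear_on KK KK D\<^sub>1"
    by (blast intro: bounded_clinear_on_invariant)+
  moreover have "U \<mu> x = pencil D\<^sub>0 D\<^sub>1 \<mu> x" if "\<mu> \<in> unit_circle" "x \<in> KK" for \<mu> x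
    using U_eq[OF that(1), of "fst x" "snd x"] that(2)
    by (simp add: pencil_def D\<^sub>0_def D\<^sub>1_def Q_def P_def scaleC_prod_def case_prod_beta
        scaleC_add_right algebra_simps)
  ultimately show ?thesis unfolding linear_pencil_def by blast
qed

text \<open>The head of the auxiliary sequence enters \<open>K\<^sub>+\<close> orthogonally to the
  range of the isometric pencil, so norm is only redistributed.\<close>

lemma norm_U: "norm (U \<mu> x) = norm x" if "\<mu> \<in> unit_circle" "x \<in> KK"
proof -
  obtain y u where x: "x = (y, u)" by fastforce
  have "ell2_nth u 0 \<in> UU" using that(2) by (simp add: x KK_eq)
  then have "(norm (U \<mu> x))\<^sup>2 = (norm x)\<^sup>2"
    using U_eq[OF that(1), of y u] that(2) norm_VQ[OF that(1)] norm_ell2_split[of u]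
    by (simp add: x norm_Pair)
  then show ?thesis by (rule power2_eq_imp_eq) simp_all
qed

lemma unitary_pencil_U: "unitary_pencil KK U"
  unfolding unitary_pencil_def unitary_on_def
proof (intro conjI ballI linear_pencil_U norm_U)
  fix \<mu> assume \<mu>: "\<mu> \<in> unit_circle"
  show cl: "bounded_clinear_on KK KK (U \<mu>)"
    by (rule linear_pencil_clinear_on[OF linear_pencil_U closed_csubspace_KK \<mu>])
  have "z \<in> U \<mu> ` KK" if "z \<in> KK" for z
  proof -
    obtain x u where z: "z = (x, u)" by fastforce
    \<comment> \<open>The component \<open>x\<close> is solved for by \<open>VQ_surj\<close>; the
      resulting \<open>w\<close> is the entry that the backward shift drops, so it is prepended to
      \<open>u\<close>.\<close>
    obtain a w where w: "w \<in> UU" and x: "pencil V\<^sub>0 V\<^sub>1 \<mu> a + Q \<mu> w = x"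
      using VQ_surj[OF \<mu>] by blast
    have "ell2_nth (ell2_cons w u) n \<in> UU" for n
      using that w by (cases n) (auto simp: z KK_eq)
    then have "(a, ell2_cons w u) \<in> KK" by (simp add: KK_eq)
    then show ?thesis
      using U_eq[OF \<mu>, of a "ell2_cons w u"] x by (intro image_eqI[of _ _ "(a, ell2_cons w u)"]) (auto simp: z)
  qed
  then show "U \<mu> ` KK = KK"
    using bounded_clinear_onD(1)[OF cl] by blast
qed

section \<open>The dilation property\<close>

lemma linear_pencil_TT: "linear_pencil HH TT"
proof -
  have *: "bounded_clinear_on HH HH (\<lambda>x. embed_H (A (comp_H (fst x))))"
    if A: "bounded_clinear A" for A :: "'h \<Rightarrow> 'h"
  proof -
    obtain K where "\<And>x. norm (A x) \<le> K * norm x"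
      using A unfolding bounded_clinear_on_def by blast
    then show ?thesis
      using bounded_clinear_onD(2,3)[OF A]
      unfolding bounded_clinear_on_def
      by (auto simp: embed_H_def comp_H_def scaleC_prod_def norm_Pair intro!: exI[of _ K])
  qed
  have "TT \<mu> x = pencil (\<lambda>x. embed_H (T\<^sub>0 (comp_H (fst x)))) (\<lambda>x. embed_H (T\<^sub>1 (comp_H (fst x)))) \<mu> x" for \<mu> x
    by (simp add: copy_pencil_def pencil_def embed_H_linear)
  then show ?thesis
    using *[OF T(1)] *[OF T(2)] unfolding linear_pencil_def by blast
qed

lemma KK_zero_sequence: "(x, 0) \<in> KK"
  using closed_csubspaceD(3)[OF closed_csubspace_UU] by (simp add: KK_eq)

lemma U_zero_sequence:
  "\<mu> \<in> unit_circle \<Longrightarrow> U \<mu> ((y, h), 0) = ((ell2_cons (pencil F\<^sub>0 F\<^sub>1 \<mu> h) y, pencil T\<^sub>0 T\<^sub>1 \<mu> h), 0)"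
  using U_eq[OF _ KK_zero_sequence, of \<mu> "(y, h)"]
  by (simp add: model_V_pencil[symmetric] model_V_def)

text \<open>Starting in the copy of \<open>H\<close>, the auxiliary sequence stays zero, and the
  entries accumulating in the copies of \<open>Y\<close> never flow back. Thus arbitrary products
  compress correctly, not only powers.\<close>

lemma foldr_U_embed_H:
  assumes "set ms \<subseteq> unit_circle"
  shows "\<exists>y. foldr U ms (embed_H h) = ((y, foldr (pencil T\<^sub>0 T\<^sub>1) ms h), 0)"
  using assms
proof (induction ms)
  case Nil
  show ?case by (auto simp: embed_H_def)
next
  case (Cons \<mu> ms)
  then obtain y where "foldr U ms (embed_H h) = ((y, foldr (pencil T\<^sub>0 T\<^sub>1) ms h), 0)" by auto
  with Cons.prems show ?case by (auto simp: U_zero_sequence)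
qed

lemma foldr_TT_embed_H: "foldr TT ms (embed_H h) = embed_H (foldr (pencil T\<^sub>0 T\<^sub>1) ms h)"
  by (induction ms) (simp_all add: copy_pencil_def comp_H_def embed_H_def)

lemma foldr_dilation:
  assumes "set ms \<subseteq> unit_circle" "x \<in> HH"
  shows "foldr TT ms x = orth_proj HH (foldr U ms x)"
proof -
  obtain h where x: "x = embed_H h" using assms(2) by blast
  show ?thesis
    using foldr_U_embed_H[OF assms(1), of h] unfolding x foldr_TT_embed_H
    by (auto simp: orth_proj_embed_H)
qed

lemma uniform_dilation_U: "uniform_dilation HH TT KK U"
proof -
  \<comment> \<open>A power is the product over a constant list.\<close>
  have "(TT \<mu> ^^ n) x = orth_proj HH ((U \<mu> ^^ n) x)" if "\<mu> \<in> unit_circle" "x \<in> HH" for \<mu> n x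
    using foldr_dilation[of "replicate n \<mu>" x] that by (auto simp: foldr_replicate set_replicate_conv_if)
  moreover have "HH \<subseteq> KK"
    by (auto simp: embed_H_def intro: KK_zero_sequence)
  ultimately show ?thesis
    unfolding uniform_dilation_def dilation_def
    using foldr_dilation linear_pencil_U linear_pencil_TT closed_csubspace_KK
      closed_csubspace_range_embed_H by blast
qed

section \<open>Minimality\<close>

lemma unitary_compression_eq_KK:
  assumes M: "closed_csubspace M" and HM: "HH \<subseteq> M" and MK: "M \<subseteq> KK"
    and un: "\<And>\<mu>. \<mu> \<in> unit_circle \<Longrightarrow> unitary_on M (compression M U \<mu>)"
  shows "M = KK"
proof -
  note MD = closed_csubspaceD[OF M]
  \<comment> \<open>Both \<open>U \<mu>\<close> and its compression preserve norms on
    \<open>M\<close>, so projecting \<open>U \<mu> x\<close> to \<open>M\<close> loses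
    nothing.\<close>
  have inM: "U \<mu> x \<in> M" if "\<mu> \<in> unit_circle" "x \<in> M" for \<mu> x
  proof (rule mem_if_norm_orth_proj[OF M])
    show "norm (orth_proj M (U \<mu> x)) = norm (U \<mu> x)"
      using un[OF that(1)] that MK norm_U[OF that(1), of x]
      by (auto simp: unitary_on_def compression_def)
  qed
  \<comment> \<open>The compression, which now equals \<open>U \<mu>\<close> on \<open>M\<close>, is
    onto \<open>M\<close>; injectivity of \<open>U \<mu>\<close> on \<open>KK\<close> identifies the
    preimage found there with \<open>x\<close>.\<close>
  have backM: "x \<in> M" if \<mu>: "\<mu> \<in> unit_circle" and x: "x \<in> KK" "U \<mu> x \<in> M" for \<mu> x
  proof -
    obtain x' where x': "x' \<in> M" "compression M U \<mu> x' = U \<mu> x"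
      using un[OF \<mu>] x(2) unfolding unitary_on_def by (metis imageE)
    then have eq: "U \<mu> x' = U \<mu> x"
      using orth_proj_same[OF M inM[OF \<mu>]] by (simp add: compression_def)
    have "x' \<in> KK" using x'(1) MK by blast
    note cl = bounded_clinear_onD[OF linear_pencil_clinear_on[OF linear_pencil_U closed_csubspace_KK \<mu>]]
    note KD = closed_csubspaceD[OF closed_csubspace_KK]
    have "x' - x \<in> KK" using KD(6)[OF \<open>x' \<in> KK\<close> x(1)] .
    moreover have "U \<mu> (x' - x) = 0"
      using cl(2)[OF \<open>x' - x \<in> KK\<close> x(1)] eq by simp
    ultimately have "x' = x" using norm_U[OF \<mu>, of "x' - x"] by simp
    with x'(1) show ?thesis by simp
  qed
  have FM: "((ell2_single n (pencil F\<^sub>0 F\<^sub>1 \<mu> h), 0), 0) \<in> M" if \<mu>: "\<mu> \<in> unit_circle" for n \<mu> h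
  proof (induction n)
    case 0
    have "U \<mu> (embed_H h) - embed_H (pencil T\<^sub>0 T\<^sub>1 \<mu> h) \<in> M"
      using HM inM[OF \<mu>] MD(6) by blast
    then show ?case
      by (simp add: U_zero_sequence[OF \<mu>] embed_H_def)
  next
    case (Suc n)
    \<comment> \<open>With zero component in \<open>H\<close>, the operator \<open>U 1\<close> only
      shifts the entry to the next copy of \<open>Y\<close>.\<close>
    show ?case
      using inM[OF _ Suc, of 1] U_zero_sequence[of 1 "ell2_single n (pencil F\<^sub>0 F\<^sub>1 \<mu> h)" 0]
      by (simp add: pencil_zero F T)
  qed
  have Kplus: "(x, 0) \<in> M" for x
  proof (rule mem_if_orth_compl_orth[OF M])
    fix z assume z: "z \<in> orth_compl M"
    obtain y h u where zeq: "z = ((y, h), u)" by (metis surj_pair)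
    have "ell2_nth y n = 0" for n
    proof (rule ranges_total)
      have "cinner (ell2_nth y n) (pencil F\<^sub>0 F\<^sub>1 \<mu> a) = 0" if "\<mu> \<in> unit_circle" for \<mu> a
        using orth_complD[OF z FM[OF that, of n a]]
        by (simp add: zeq cinner_prod_def cinner_ell2_single)
      \<comment> \<open>The values at 1 and -1 separate the two coefficients.\<close>
      from this[of 1] this[of "-1"]
      have "cinner (ell2_nth y n) (F\<^sub>0 a) = 0 \<and> cinner (ell2_nth y n) (F\<^sub>1 a) = 0" for a
        by (simp add: pencil_def cinner_add_right cinner_scaleC_right cinner.diff_right
            add_eq_0_iff2)
      then show "ell2_nth y n \<in> orth_compl (range F\<^sub>0 \<union> range F\<^sub>1)"
        by (auto intro: orth_complI)
    qed
    then have "y = 0" by (intro ell2_eqI) simp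
    moreover have "cinner h (snd x) = 0"
      using orth_complD[OF z subsetD[OF HM], of "embed_H (snd x)"]
      by (simp add: zeq embed_H_def cinner_prod_def)
    ultimately show "cinner z (x, 0) = 0"
      by (simp add: zeq cinner_prod_def)
  qed
  \<comment> \<open>Membership is pulled back along \<open>U 1\<close>: copy 0 starts from
    \<open>Kplus\<close>, each later copy from its predecessor.\<close>
  have copies: "(0, ell2_single n w) \<in> M" if w: "w \<in> UU" for n w
  proof (induction n)
    case 0
    have K: "(0, ell2_single 0 w) \<in> KK"
      using w closed_csubspaceD(3)[OF closed_csubspace_UU] by (simp add: KK_eq ell2_nth_single del: ell2_single.simps)
    have "U 1 (0, ell2_single 0 w) = (Q 1 w, 0)"
      using U_eq[OF _ K, of 1] pencil_zero[OF V0 V1] by simp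
    then show ?case
      using backM[OF _ K, of 1] Kplus by simp
  next
    case (Suc n)
    have K: "(0, ell2_single (Suc n) w) \<in> KK"
      using w closed_csubspaceD(3)[OF closed_csubspace_UU] by (simp add: KK_eq ell2_nth_single del: ell2_single.simps)
    have "U 1 (0, ell2_single (Suc n) w) = (0, ell2_single n w)"
      using U_eq[OF _ K, of 1] pencil_zero[OF V0 V1] by simp
    then show ?case
      using backM[OF _ K, of 1] Suc by simp
  qed
  have "x \<in> M" if "x \<in> KK" for x
  proof (rule mem_if_orth_compl_orth[OF M])
    fix z assume z: "z \<in> orth_compl M"
    \<comment> \<open>Each coordinate of \<open>x\<close> gives a vector of \<open>M\<close>, so the
      inner product of the sequences is a series of zeros.\<close>
    have "cinner (ell2_nth (snd z) n) (ell2_nth (snd x) n) = 0" for n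
      using orth_complD[OF z copies[of "ell2_nth (snd x) n" n]] that
      by (simp add: KK_eq case_prod_beta cinner_prod_def[of z] cinner_ell2_single)
    then have "cinner (snd z) (snd x) = 0"
      by (simp add: cinner_ell2_def)
    moreover have "cinner (fst z) (fst x) = 0"
      using orth_complD[OF z Kplus[of "fst x"]] by (simp add: cinner_prod_def[of z])
    ultimately show "cinner z x = 0"
      by (simp add: cinner_prod_def[of z])
  qed
  with MK show ?thesis by blast
qed

end

theorem theorem3p6:
  fixes T\<^sub>0 T\<^sub>1 :: "'h::complex_hilbert \<Rightarrow> 'h"
    and F\<^sub>0 F\<^sub>1 :: "'h \<Rightarrow> 'y::complex_hilbert"
  assumes "separable_space (euclidean :: 'h topology)"
    and "separable_space (euclidean :: 'y topology)"
    and "bounded_clinear T\<^sub>0" and "bounded_clinear T\<^sub>1"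
    and "contractive_pencil UNIV (pencil T\<^sub>0 T\<^sub>1)"
    and "bounded_clinear F\<^sub>0" and "bounded_clinear F\<^sub>1"
    and "outer (pencil F\<^sub>0 F\<^sub>1)"
    and "\<forall>\<mu>\<in>unit_circle. \<forall>h.
      cadjoint (pencil F\<^sub>0 F\<^sub>1 \<mu>) (pencil F\<^sub>0 F\<^sub>1 \<mu> h)
        = h - cadjoint (pencil T\<^sub>0 T\<^sub>1 \<mu>) (pencil T\<^sub>0 T\<^sub>1 \<mu> h)"
  shows "minimal_unitary_dilation
      (range embed_H) (copy_pencil (pencil T\<^sub>0 T\<^sub>1))
      (space_K T\<^sub>0 T\<^sub>1 F\<^sub>0 F\<^sub>1) (model_U T\<^sub>0 T\<^sub>1 F\<^sub>0 F\<^sub>1)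
    \<and> minimal_uniform_unitary_dilation
      (range embed_H) (copy_pencil (pencil T\<^sub>0 T\<^sub>1))
      (space_K T\<^sub>0 T\<^sub>1 F\<^sub>0 F\<^sub>1) (model_U T\<^sub>0 T\<^sub>1 F\<^sub>0 F\<^sub>1)"
proof -
  interpret model_dilation T\<^sub>0 T\<^sub>1 F\<^sub>0 F\<^sub>1
  proof
    fix \<mu> h assume \<mu>: "\<mu> \<in> unit_circle"
    let ?F = "pencil F\<^sub>0 F\<^sub>1 \<mu>" and ?T = "pencil T\<^sub>0 T\<^sub>1 \<mu>"
    have F: "bounded_clinear ?F" and T: "bounded_clinear ?T"
      using assms by (simp_all add: bounded_clinear_pencil)
    \<comment> \<open>Pairing the operator factorization with \<open>h\<close> gives the norm
      identity of the locale.\<close>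
    have "cinner (?F h) (?F h) = cinner h h - cinner (?T h) (?T h)"
      unfolding cinner_cadjoint[OF F] cinner_cadjoint[OF T]
      using assms(9) \<mu> by (simp add: cinner.diff_right)
    then have "complex_of_real ((norm (?F h))\<^sup>2 + (norm (?T h))\<^sup>2) = complex_of_real ((norm h)\<^sup>2)"
      unfolding cinner_self by (simp add: algebra_simps)
    then show "(norm (?F h))\<^sup>2 + (norm (?T h))\<^sup>2 = (norm h)\<^sup>2"
      by (simp only: of_real_eq_iff)
  qed (use assms outer_pencil_ranges_total in auto)
  have dil: "dilation HH TT KK U"
    using uniform_dilation_U by (simp add: uniform_dilation_def)
  have min: "M = KK" if "closed_csubspace M" "HH \<subseteq> M" "M \<subseteq> KK" "unitary_pencil M (compression M U)" for M
    using that by (intro unitary_compression_eq_KK) (simp_all add: unitary_pencil_def)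
  show ?thesis
    unfolding minimal_unitary_dilation_def minimal_uniform_unitary_dilation_def
      unitary_dilation_def uniform_unitary_dilation_def
    by (intro conjI allI impI dil uniform_dilation_U unitary_pencil_U; elim conjE; rule min; assumption)
qed

end
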